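(* Let $Y$ be a locally compact Hausdorff space. Every uniformly closed extremely $C$-regular $\mathbb{C}$-linear subspace of $C_0(Y,\mathbb{C})$ has the complex Mazur-Ulam property. In particular, $C_0(Y,\mathbb{C})$ itself and every uniformly closed extremely regular $\mathbb{C}$-linear subspace of $C_0(Y,\mathbb{C})$ have the complex Mazur-Ulam property.
   Context: $C_0(Y,\mathbb{C})$ is the space of complex continuous functions on $Y$ vanishing at infinity with the supremum norm $\|\cdot\|_\infty$. For a $\mathbb{C}$-linear subspace $E$ of $C_0(Y,\mathbb{C})$, the Choquet boundary $\operatorname{Ch}(E)$ is the set of all $x\in Y$ such that the point evaluation $\tau_x:E\to\mathbb{C}$, $\tau_x(f)=f(x)$, is an extreme point of the closed unit ball of $E^*$. $E$ is extremely $C$-regular (resp. extremely regular) if for each $x\in\operatorname{Ch}(E)$ (resp. each $x\in Y$), each $\varepsilon>0$ and each open neighborhood $U$ of $x$, there exists $f\in E$ such that $f(x)=1=\|f\|_\infty$ and $|f|<\varepsilon$ on $Y\setminus U$. A complex Banach space $B$ has the complex Mazur-Ulam property if for any complex Banach space $B'$, every surjective isometry from the unit sphere of $B$ onto the unit sphere of $B'$ admits an extension to a surjective real-linear isometry from $B$ onto $B'$. *)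

theory Defs
  imports "HOL-Analysis.Analysis" "HOL-Library.Function_Algebras"
begin

class scaleC =
  fixes scaleC :: "complex \<Rightarrow> 'a \<Rightarrow> 'a" (infixr "*\<^sub>C" 75)

class complex_normed_vector = real_normed_vector + scaleC +
  assumes scaleC_add_right: "a *\<^sub>C (x + y) = a *\<^sub>C x + a *\<^sub>C y"
    and scaleC_add_left: "(a + b) *\<^sub>C x = a *\<^sub>C x + b *\<^sub>C x"
    and scaleC_scaleC: "a *\<^sub>C b *\<^sub>C x = (a * b) *\<^sub>C x"
    and scaleC_one: "1 *\<^sub>C x = x"
    and scaleR_scaleC: "r *\<^sub>R x = complex_of_real r *\<^sub>C x"
    and norm_scaleC: "norm (a *\<^sub>C x) = cmod a * norm x"

global_interpretation complex_vector: vector_space "scaleC :: complex \<Rightarrow> 'a \<Rightarrow> 'a::complex_normed_vector"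
  by unfold_locales (simp_all add: scaleC_add_right scaleC_add_left scaleC_scaleC scaleC_one)

instantiation complex :: complex_normed_vector
begin

definition scaleC_complex :: "complex \<Rightarrow> complex \<Rightarrow> complex"
  where [simp]: "scaleC_complex a x = a * x"

instance
  by standard (simp_all add: algebra_simps norm_mult scaleR_conv_of_real)

end

lemma bounded_linear_scaleC: "bounded_linear (\<lambda>x::'a::complex_normed_vector. a *\<^sub>C x)"
  by (rule bounded_linear_intro[where K = "cmod a"])
     (simp_all add: scaleC_add_right scaleR_scaleC scaleC_scaleC norm_scaleC mult.commute)

lemma scaleC_cont:
  fixes f :: "'a::topological_space \<Rightarrow> 'b::complex_normed_vector"
  assumes "f \<in> bcontfun"
  shows "(\<lambda>x. a *\<^sub>C f x) \<in> bcontfun"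
proof -
  have "continuous_on UNIV (\<lambda>x. a *\<^sub>C f x)"
    using assms by (auto simp: bcontfun_def intro: bounded_linear.continuous_on[OF bounded_linear_scaleC])
  moreover have "bounded ((\<lambda>y. a *\<^sub>C y) ` range f)"
    using assms by (intro bounded_linear_image bounded_linear_scaleC) (simp add: bcontfun_def)
  ultimately show ?thesis
    by (simp add: bcontfun_def image_image)
qed

instantiation bcontfun :: (topological_space, complex_normed_vector) complex_normed_vector
begin

definition scaleC_bcontfun :: "complex \<Rightarrow> ('a \<Rightarrow>\<^sub>C 'b) \<Rightarrow> 'a \<Rightarrow>\<^sub>C 'b"
  where "scaleC_bcontfun a f = Bcontfun (\<lambda>x. a *\<^sub>C apply_bcontfun f x)"

lemma apply_bcontfun_scaleC: "apply_bcontfun (a *\<^sub>C f) x = a *\<^sub>C apply_bcontfun f x"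
  for f :: "'a \<Rightarrow>\<^sub>C 'b"
  unfolding scaleC_bcontfun_def
  by (subst Bcontfun_inverse) (auto intro: scaleC_cont apply_bcontfun)

lemma norm_scaleC_bcontfun_le: "norm (a *\<^sub>C f) \<le> cmod a * norm f" for f :: "'a \<Rightarrow>\<^sub>C 'b"
  by (rule norm_bound)
     (simp add: apply_bcontfun_scaleC norm_scaleC mult_left_mono norm_bounded)

instance
proof
  fix a b :: complex and r :: real and f g :: "'a \<Rightarrow>\<^sub>C 'b"
  show "a *\<^sub>C (f + g) = a *\<^sub>C f + a *\<^sub>C g"
    by (rule bcontfun_eqI) (simp add: apply_bcontfun_scaleC scaleC_add_right)
  show "(a + b) *\<^sub>C f = a *\<^sub>C f + b *\<^sub>C f"
    by (rule bcontfun_eqI) (simp add: apply_bcontfun_scaleC scaleC_add_left)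
  show sc: "a *\<^sub>C b *\<^sub>C f = (a * b) *\<^sub>C f" for a b
    by (rule bcontfun_eqI) (simp add: apply_bcontfun_scaleC scaleC_scaleC)
  show one: "1 *\<^sub>C f = f"
    by (rule bcontfun_eqI) (simp add: apply_bcontfun_scaleC scaleC_one)
  show "r *\<^sub>R f = complex_of_real r *\<^sub>C f"
    by (rule bcontfun_eqI) (simp add: apply_bcontfun_scaleC scaleR_scaleC)
  show "norm (a *\<^sub>C f) = cmod a * norm f"
  proof (cases "a = 0")
    case True
    then show ?thesis
      using norm_scaleC_bcontfun_le[of a f] by simp
  next
    case False
    have "norm f = norm (inverse a *\<^sub>C a *\<^sub>C f)"
      using False by (simp add: sc one)
    also have "\<dots> \<le> cmod (inverse a) * norm (a *\<^sub>C f)"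
      by (rule norm_scaleC_bcontfun_le)
    finally have "cmod a * norm f \<le> norm (a *\<^sub>C f)"
      using False unfolding norm_inverse by (simp add: field_simps)
    with norm_scaleC_bcontfun_le[of a f] show ?thesis
      by simp
  qed
qed

end

text \<open>The pointwise real vector space structure on functions makes \<^const>\<open>extreme_point_of\<close>
  available for sets of functionals.\<close>

instantiation "fun" :: (type, real_vector) real_vector
begin

definition scaleR_fun :: "real \<Rightarrow> ('a \<Rightarrow> 'b) \<Rightarrow> 'a \<Rightarrow> 'b"
  where "scaleR_fun r f = (\<lambda>x. r *\<^sub>R f x)"

instance
  by standard (simp_all add: scaleR_fun_def fun_eq_iff algebra_simps)

end

text \<open>A complex Banach space is a complete complex subspace of an ambient complex normed space,
  with the inherited operations and norm; the ambient space itself need not be complete.\<close>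

definition complex_banach_space :: "'a::complex_normed_vector set \<Rightarrow> bool"
  where "complex_banach_space B \<longleftrightarrow> complex_vector.subspace B \<and> complete B"

text \<open>The functionals on \<open>E\<close> are represented by functions on the ambient type that are \<open>0\<close> off
  \<open>E\<close>, so that equality of functionals on \<open>E\<close> is equality of functions.\<close>

definition dual_space :: "'a::complex_normed_vector set \<Rightarrow> ('a \<Rightarrow> complex) set"
  where "dual_space E = {\<phi>.
    (\<forall>f\<in>E. \<forall>g\<in>E. \<phi> (f + g) = \<phi> f + \<phi> g) \<and>
    (\<forall>c. \<forall>f\<in>E. \<phi> (c *\<^sub>C f) = c * \<phi> f) \<and>
    (\<exists>K. \<forall>f\<in>E. cmod (\<phi> f) \<le> K * norm f) \<and>
    (\<forall>f. f \<notin> E \<longrightarrow> \<phi> f = 0)}"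

definition dual_norm :: "'a::complex_normed_vector set \<Rightarrow> ('a \<Rightarrow> complex) \<Rightarrow> real"
  where "dual_norm E \<phi> = (SUP f\<in>{f\<in>E. norm f \<le> 1}. cmod (\<phi> f))"

definition point_evaluation ::
    "('y::topological_space \<Rightarrow>\<^sub>C complex) set \<Rightarrow> 'y \<Rightarrow> ('y \<Rightarrow>\<^sub>C complex) \<Rightarrow> complex"
  where "point_evaluation E x = (\<lambda>f. if f \<in> E then apply_bcontfun f x else 0)"

definition Choquet_boundary :: "('y::topological_space \<Rightarrow>\<^sub>C complex) set \<Rightarrow> 'y set"
  where "Choquet_boundary E =
    {x. point_evaluation E x extreme_point_of {\<phi>\<in>dual_space E. dual_norm E \<phi> \<le> 1}}"

text \<open>\<open>C\<^sub>0(Y, \<complex>)\<close>, where \<open>Y\<close> is the whole type \<open>'y\<close>; the norm of \<open>'y \<Rightarrow>\<^sub>C complex\<close> is the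
  supremum norm.\<close>

definition C0 :: "('y::topological_space \<Rightarrow>\<^sub>C complex) set"
  where "C0 = {f. \<forall>\<epsilon>>0. \<exists>K. compact K \<and> (\<forall>y. y \<notin> K \<longrightarrow> cmod (apply_bcontfun f y) < \<epsilon>)}"

definition peaks_at :: "('y::topological_space \<Rightarrow>\<^sub>C complex) set \<Rightarrow> 'y \<Rightarrow> bool"
  where "peaks_at E x \<longleftrightarrow> (\<forall>\<epsilon>>0. \<forall>U. open U \<longrightarrow> x \<in> U \<longrightarrow>
    (\<exists>f\<in>E. apply_bcontfun f x = 1 \<and> norm f = 1 \<and> (\<forall>y. y \<notin> U \<longrightarrow> cmod (apply_bcontfun f y) < \<epsilon>)))"

definition extremely_C_regular :: "('y::topological_space \<Rightarrow>\<^sub>C complex) set \<Rightarrow> bool"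
  where "extremely_C_regular E \<longleftrightarrow> (\<forall>x\<in>Choquet_boundary E. peaks_at E x)"

definition extremely_regular :: "('y::topological_space \<Rightarrow>\<^sub>C complex) set \<Rightarrow> bool"
  where "extremely_regular E \<longleftrightarrow> (\<forall>x. peaks_at E x)"

definition unit_sphere :: "'a::real_normed_vector set \<Rightarrow> 'a set"
  where "unit_sphere B = {x\<in>B. norm x = 1}"

definition surj_isometry ::
    "'a::metric_space set \<Rightarrow> 'b::metric_space set \<Rightarrow> ('a \<Rightarrow> 'b) \<Rightarrow> bool"
  where "surj_isometry A B T \<longleftrightarrow> T ` A = B \<and> (\<forall>x\<in>A. \<forall>y\<in>A. dist (T x) (T y) = dist x y)"

definition real_linear_on ::
    "'a::real_vector set \<Rightarrow> ('a \<Rightarrow> 'b::real_vector) \<Rightarrow> bool"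
  where "real_linear_on B S \<longleftrightarrow>
    (\<forall>x\<in>B. \<forall>y\<in>B. S (x + y) = S x + S y) \<and> (\<forall>r. \<forall>x\<in>B. S (r *\<^sub>R x) = r *\<^sub>R S x)"

text \<open>HOL cannot quantify over types inside a formula. The type argument names the ambient type of
  the target spaces \<open>B'\<close>; the quantification over all complex Banach spaces is completed
  by stating the property for an arbitrary type \<open>'b\<close>.\<close>

definition complex_Mazur_Ulam ::
    "'b::complex_normed_vector itself \<Rightarrow> 'a::complex_normed_vector set \<Rightarrow> bool"
  where "complex_Mazur_Ulam TYPE('b) B \<longleftrightarrow> complex_banach_space B \<and>
    (\<forall>(B' :: 'b set) T. complex_banach_space B' \<longrightarrow>
      surj_isometry (unit_sphere B) (unit_sphere B') T \<longrightarrow>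
      (\<exists>S. real_linear_on B S \<and> surj_isometry B B' S \<and> (\<forall>x\<in>unit_sphere B. S x = T x)))"

end

theory Submission
  imports Defs
begin

text \<open>Let \<open>E\<close> be closed and extremely \<open>C\<close>-regular, \<open>B\<close> a complex Banach space and \<open>T\<close> a surjective
  isometry between their unit spheres. The idea is to recover each value \<open>f x\<close>, for enough points
  \<open>x\<close> of the Choquet boundary, as \<open>R (T f)\<close> with a real-linear functional \<open>R\<close> that does not depend
  on \<open>f\<close>. Once this is done, the radial extension \<open>f \<mapsto> \<parallel>f\<parallel> T (f / \<parallel>f\<parallel>)\<close> is real-linear: the
  vector that measures its failure to be additive or homogeneous is killed by all these
  functionals, while every unit vector \<open>T k\<close> is seen with modulus \<open>1\<close> by one of them
  (\<open>vanishes_if_evaluations_vanish\<close>).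

  The functionals come from maximal convex subsets \<open>C\<close> of the unit sphere of \<open>B\<close>. The key fact
  (\<open>preimage_maximal_convex\<close>) is that \<open>T\<close> pulls such a set back to a face
  \<open>{f. \<parallel>f\<parallel> = 1, f x = c}\<close>, with \<open>x\<close> in the Choquet boundary and \<open>c\<close> unimodular, and that
  \<open>T\<close> maps the opposite face to \<open>-C\<close>. Metric information only controls norms of sums of two
  vectors, \<open>\<parallel>f + a\<parallel> = \<parallel>T f - T (-a)\<parallel>\<close>; the midpoints of \<open>C\<close> turn it into a directed family of
  functions on the other side, whose peak sets meet by compactness. That they meet
  in the Choquet boundary needs a Krein-Milman argument, which is carried out directly on sets of
  rotated point evaluations (\<open>extremal_meets_Choquet_boundary\<close>).

  Multiplication by a unimodular \<open>\<mu>\<close> permutes the maximal convex sets of \<open>B\<close> and moves points by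
  \<open>\<bar>1 - \<mu>\<bar>\<close>. Comparing with distances between faces of \<open>E\<close> shows that \<open>\<mu> C\<close> comes from the same
  point \<open>x\<close>, and that \<open>c\<close> is multiplied by an isometry of the circle fixing \<open>1\<close>, so by \<open>\<mu>\<close> or by
  its conjugate. If \<open>q\<close> is a complex functional of norm at most \<open>1\<close> with \<open>q = 1\<close> on \<open>C\<close>, then
  \<open>q (T g)\<close> is determined by two distances: \<open>g\<close> has distance at most \<open>1 - \<bar>g x\<bar>\<close> from the face with the phase
  of \<open>g x\<close> and at most \<open>1 + \<bar>g x\<bar>\<close> from the opposite one (\<open>near_face\<close>, \<open>near_opposite_face\<close>), and the
  two corresponding discs touch in a single point.\<close>

section \<open>Extremal sets of rotated point evaluations\<close>

lemma apply_bcontfun_scale [simp]: "apply_bcontfun (a *\<^sub>C f) x = a * apply_bcontfun f x"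
  for f :: "'y::topological_space \<Rightarrow>\<^sub>C complex"
  by (simp add: apply_bcontfun_scaleC)

text \<open>The closed set \<open>Z\<close> makes the lemma double as a statement about suprema: with
  \<open>Z = {k. c \<le> u k}\<close> it says that a continuous \<open>u\<close> which is below \<open>c\<close> on the whole intersection is
  already below \<open>c\<close> on some member.\<close>

lemma directed_compact_Inter_nonempty:
  fixes \<S> :: "'a::t2_space set set"
  assumes ne: "\<S> \<noteq> {}" and "closed Z"
    and comp: "\<And>S. S \<in> \<S> \<Longrightarrow> compact S"
    and dir: "\<And>S T. S \<in> \<S> \<Longrightarrow> T \<in> \<S> \<Longrightarrow> \<exists>R\<in>\<S>. R \<subseteq> S \<inter> T"
    and meets: "\<And>S. S \<in> \<S> \<Longrightarrow> S \<inter> Z \<noteq> {}"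
  shows "\<Inter>\<S> \<inter> Z \<noteq> {}"
proof -
  obtain S\<^sub>0 where S0: "S\<^sub>0 \<in> \<S>"
    using ne by auto
  have fin: "\<exists>R\<in>\<S>. R \<subseteq> S\<^sub>0 \<inter> \<Inter>\<F>" if "finite \<F>" "\<F> \<subseteq> \<S>" for \<F>
    using that
  proof (induction \<F> rule: finite_induct)
    case empty
    then show ?case using S0 by auto
  next
    case (insert T \<F>)
    then obtain R where R: "R \<in> \<S>" "R \<subseteq> S\<^sub>0 \<inter> \<Inter>\<F>" by auto
    obtain R' where "R' \<in> \<S>" "R' \<subseteq> R \<inter> T"
      using dir[OF R(1), of T] insert.prems by auto
    then show ?case using R by (intro bexI[of _ R']) auto
  qed
  have "(S\<^sub>0 \<inter> Z) \<inter> \<Inter>\<S> \<noteq> {}"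
  proof (rule compact_imp_fip)
    show "compact (S\<^sub>0 \<inter> Z)"
      using comp[OF S0] \<open>closed Z\<close> by (rule compact_Int_closed)
    show "closed T" if "T \<in> \<S>" for T
      using comp[OF that] by (rule compact_imp_closed)
    show "S\<^sub>0 \<inter> Z \<inter> \<Inter>\<F> \<noteq> {}" if F: "finite \<F>" "\<F> \<subseteq> \<S>" for \<F>
    proof -
      obtain R where R: "R \<in> \<S>" "R \<subseteq> S\<^sub>0 \<inter> \<Inter>\<F>"
        using fin[OF F] by auto
      obtain z where "z \<in> R" "z \<in> Z"
        using meets[OF R(1)] by auto
      then have "z \<in> S\<^sub>0 \<inter> Z \<inter> \<Inter>\<F>"
        using R(2) by auto
      then show ?thesis by auto
    qed
  qed
  then show ?thesis by auto
qed

lemma compact_Inter_t2: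
  fixes \<S> :: "'a::t2_space set set"
  assumes "S \<in> \<S>" and comp: "\<And>S. S \<in> \<S> \<Longrightarrow> compact S"
  shows "compact (\<Inter>\<S>)"
proof -
  have "compact (S \<inter> \<Inter>\<S>)"
    using assms by (intro compact_Int_closed closed_Inter) (auto intro: compact_imp_closed)
  moreover have "S \<inter> \<Inter>\<S> = \<Inter>\<S>" using assms(1) by blast
  ultimately show ?thesis by simp
qed

text \<open>A pair \<open>(\<mu>, x)\<close> stands for the functional \<open>f \<mapsto> \<mu> f x\<close>. Working with pairs instead of functionals
  gives access to the product topology of the plane and the underlying space, which replaces the
  weak-star topology.\<close>

definition rotated_eval :: "complex \<times> 'y::topological_space \<Rightarrow> ('y \<Rightarrow>\<^sub>C complex) \<Rightarrow> real"
  where "rotated_eval k f = Re (fst k * apply_bcontfun f (snd k))"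

definition rotations :: "(complex \<times> 'y) set"
  where "rotations = sphere 0 1 \<times> UNIV"

lemma rotated_eval_add: "rotated_eval k (f + g) = rotated_eval k f + rotated_eval k g"
  by (simp add: rotated_eval_def algebra_simps)

lemma rotated_eval_scale: "rotated_eval k (complex_of_real t *\<^sub>C f) = t * rotated_eval k f"
  by (simp add: rotated_eval_def algebra_simps)

lemma rotated_eval_minus: "rotated_eval k (- f) = - rotated_eval k f"
  by (simp add: rotated_eval_def)

lemma continuous_rotated_eval: "continuous_on UNIV (\<lambda>k. rotated_eval k f)"
proof -
  have "continuous_on UNIV (\<lambda>k::complex \<times> 'a. apply_bcontfun f (snd k))"
    by (rule continuous_on_compose2[OF continuous_on_apply_bcontfun[of UNIV f]])
       (auto intro: continuous_intros)
  then show ?thesis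
    unfolding rotated_eval_def by (intro continuous_intros) auto
qed

lemma closed_rotated_eval_ge: "closed {k. c \<le> rotated_eval k f}"
  by (intro closed_Collect_le continuous_rotated_eval continuous_on_const)

lemma closed_rotated_eval_eq: "closed {k. rotated_eval k f = c}"
  by (intro closed_Collect_eq continuous_rotated_eval continuous_on_const)

lemma rotated_eval_le_norm:
  assumes "k \<in> rotations"
  shows "rotated_eval k f \<le> norm f"
proof -
  have "rotated_eval k f \<le> cmod (fst k * f (snd k))"
    unfolding rotated_eval_def by (rule complex_Re_le_cmod)
  also have "\<dots> = cmod (f (snd k))"
    using assms by (auto simp: rotations_def norm_mult)
  also have "\<dots> \<le> norm f"
    by (rule norm_bounded)
  finally show ?thesis .
qed

lemma norm_le_if_rotated_eval_le:
  assumes "\<And>k. k \<in> rotations \<Longrightarrow> rotated_eval k f \<le> M" and "M \<ge> 0"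
  shows "norm f \<le> M"
proof (rule norm_bound)
  fix x
  show "cmod (f x) \<le> M"
  proof (cases "f x = 0")
    case False
    have "(cnj (sgn (f x)), x) \<in> rotations"
      using False by (simp add: rotations_def norm_sgn)
    then have "Re (cnj (sgn (f x)) * f x) \<le> M"
      using assms(1) by (fastforce simp: rotated_eval_def)
    moreover have "cnj (sgn (f x)) * f x = cmod (f x)"
      using False by (simp add: sgn_eq complex_norm_square[symmetric] power2_eq_square mult.commute)
    ultimately show ?thesis by simp
  qed (use assms(2) in simp)
qed

locale C0_subspace =
  fixes E :: "('y::t2_space \<Rightarrow>\<^sub>C complex) set"
  assumes C0: "E \<subseteq> C0"
    and subspace: "complex_vector.subspace E"
begin

lemma
  shows E_zero [simp]: "0 \<in> E"
    and E_add: "\<And>f g. f \<in> E \<Longrightarrow> g \<in> E \<Longrightarrow> f + g \<in> E"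
    and E_diff: "\<And>f g. f \<in> E \<Longrightarrow> g \<in> E \<Longrightarrow> f - g \<in> E"
    and E_scaleC: "\<And>c f. f \<in> E \<Longrightarrow> c *\<^sub>C f \<in> E"
    and E_uminus: "\<And>f. f \<in> E \<Longrightarrow> - f \<in> E"
  using complex_vector.subspace_0[OF subspace] complex_vector.subspace_add[OF subspace]
    complex_vector.subspace_diff[OF subspace] complex_vector.subspace_scale[OF subspace]
    complex_vector.subspace_neg[OF subspace] by simp_all

lemma E_scaleR: "f \<in> E \<Longrightarrow> r *\<^sub>R f \<in> E"
  by (simp add: scaleR_scaleC E_scaleC)

abbreviation dual_ball :: "(('y \<Rightarrow>\<^sub>C complex) \<Rightarrow> complex) set"
  where "dual_ball \<equiv> {\<phi> \<in> dual_space E. dual_norm E \<phi> \<le> 1}"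

lemma dual_add: "\<phi> \<in> dual_space E \<Longrightarrow> f \<in> E \<Longrightarrow> g \<in> E \<Longrightarrow> \<phi> (f + g) = \<phi> f + \<phi> g"
  and dual_scaleC: "\<phi> \<in> dual_space E \<Longrightarrow> f \<in> E \<Longrightarrow> \<phi> (c *\<^sub>C f) = c * \<phi> f"
  and dual_outside: "\<phi> \<in> dual_space E \<Longrightarrow> f \<notin> E \<Longrightarrow> \<phi> f = 0"
  by (auto simp: dual_space_def)

lemma dual_ball_le:
  assumes "\<phi> \<in> dual_ball" "f \<in> E"
  shows "cmod (\<phi> f) \<le> norm f"
proof (cases "f = 0")
  case True
  then show ?thesis
    using dual_scaleC[of \<phi> f 0] assms by simp
next
  case False
  obtain K where K: "\<And>g. g \<in> E \<Longrightarrow> cmod (\<phi> g) \<le> K * norm g"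
    using assms(1) unfolding dual_space_def by blast
  have bdd: "bdd_above ((\<lambda>g. cmod (\<phi> g)) ` {g \<in> E. norm g \<le> 1})"
  proof (rule bdd_aboveI2)
    fix g assume g: "g \<in> {g \<in> E. norm g \<le> 1}"
    then have "cmod (\<phi> g) \<le> \<bar>K\<bar> * norm g"
      using K[of g] by (intro order_trans[OF K[of g]] mult_right_mono) auto
    also have "\<dots> \<le> \<bar>K\<bar> * 1"
      using g by (intro mult_left_mono) auto
    finally show "cmod (\<phi> g) \<le> \<bar>K\<bar>" by simp
  qed
  define g where "g = complex_of_real (inverse (norm f)) *\<^sub>C f"
  have "g \<in> E" "norm g \<le> 1"
    using assms False by (auto simp: g_def E_scaleC norm_scaleC norm_inverse)
  then have "cmod (\<phi> g) \<le> dual_norm E \<phi>"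
    unfolding dual_norm_def using bdd by (intro cSUP_upper) auto
  also have "\<dots> \<le> 1" using assms by auto
  finally have "inverse (norm f) * cmod (\<phi> f) \<le> 1"
    using assms dual_scaleC[of \<phi> f] by (simp add: g_def norm_mult norm_inverse)
  then show ?thesis
    using False by (simp add: field_simps)
qed

lemma dual_ballI:
  assumes "\<phi> \<in> dual_space E" "\<And>f. f \<in> E \<Longrightarrow> cmod (\<phi> f) \<le> norm f"
  shows "\<phi> \<in> dual_ball"
proof -
  have "dual_norm E \<phi> \<le> 1"
    unfolding dual_norm_def
    using assms(2) E_zero by (intro cSUP_least) (auto intro: order_trans exI[of _ 0])
  then show ?thesis using assms by simp
qed

lemma scaled_dual_ball:
  assumes "\<phi> \<in> dual_ball" "cmod c \<le> 1"
  shows "(\<lambda>f. c * \<phi> f) \<in> dual_ball"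
proof (rule dual_ballI)
  have le: "cmod (c * \<phi> f) \<le> norm f" if "f \<in> E" for f
    using mult_mono[OF assms(2) dual_ball_le[OF assms(1) that]] by (simp add: norm_mult)
  then show "(\<lambda>f. c * \<phi> f) \<in> dual_space E"
    using assms(1) unfolding dual_space_def
    by (auto simp: algebra_simps intro!: exI[of _ 1])
  show "cmod (c * \<phi> f) \<le> norm f" if "f \<in> E" for f
    using le that by simp
qed

lemma point_evaluation_dual_ball: "point_evaluation E x \<in> dual_ball"
proof (rule dual_ballI)
  show "point_evaluation E x \<in> dual_space E"
    unfolding dual_space_def point_evaluation_def
    by (auto simp: E_add E_scaleC norm_bounded intro!: exI[of _ 1])
  show "cmod (point_evaluation E x f) \<le> norm f" for f
    by (simp add: point_evaluation_def norm_bounded)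
qed

text \<open>In terms of support functions this says that \<open>\<phi>\<close> lies in the weak-star closed convex hull of the
  functionals given by \<open>S\<close>.\<close>

definition dominated :: "(complex \<times> 'y) set \<Rightarrow> (('y \<Rightarrow>\<^sub>C complex) \<Rightarrow> complex) \<Rightarrow> bool"
  where "dominated S \<phi> \<longleftrightarrow>
    (\<forall>f\<in>E. \<forall>M. (\<forall>k\<in>S. rotated_eval k f \<le> M) \<longrightarrow> Re (\<phi> f) \<le> M)"

text \<open>Sets whose closed convex hull is a face of the dual ball. Phrasing the hull through \<open>dominated\<close>
  avoids both the weak-star topology and any separation theorem.\<close>

definition extremal :: "(complex \<times> 'y) set \<Rightarrow> bool"
  where "extremal S \<longleftrightarrow> S \<subseteq> rotations \<and>
    (\<forall>\<phi>\<in>dual_ball. \<forall>\<psi>\<in>dual_ball. \<forall>t. 0 < t \<longrightarrow> t < 1 \<longrightarrow>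
      dominated S (\<lambda>f. of_real (1 - t) * \<phi> f + of_real t * \<psi> f) \<longrightarrow> dominated S \<phi> \<and> dominated S \<psi>)"

lemma dominatedD: "dominated S \<phi> \<Longrightarrow> f \<in> E \<Longrightarrow> (\<And>k. k \<in> S \<Longrightarrow> rotated_eval k f \<le> M) \<Longrightarrow> Re (\<phi> f) \<le> M"
  by (auto simp: dominated_def)

lemma extremalD:
  assumes "extremal S" "\<phi> \<in> dual_ball" "\<psi> \<in> dual_ball" "0 < t" "t < 1"
    and "dominated S (\<lambda>f. of_real (1 - t) * \<phi> f + of_real t * \<psi> f)"
  shows "dominated S \<phi>" "dominated S \<psi>"
  using assms unfolding extremal_def by blast+

lemma dominated_mono: "dominated S \<phi> \<Longrightarrow> S \<subseteq> T \<Longrightarrow> dominated T \<phi>"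
  unfolding dominated_def by blast

text \<open>The hull of all rotated evaluations is the whole dual ball, because their supremum at \<open>f\<close> is the
  norm of \<open>f\<close>.\<close>

lemma extremal_rotations: "extremal rotations"
proof -
  have "dominated rotations \<phi>" if "\<phi> \<in> dual_ball" for \<phi>
    unfolding dominated_def
  proof (intro ballI allI impI)
    fix f M assume f: "f \<in> E" and M: "\<forall>k\<in>rotations. rotated_eval k f \<le> M"
    have "(1, undefined) \<in> rotations" "(-1, undefined) \<in> rotations"
      by (auto simp: rotations_def)
    then have "rotated_eval (1, undefined) f \<le> M" "rotated_eval (-1, undefined) f \<le> M"
      using M by auto
    then have "M \<ge> 0" by (auto simp: rotated_eval_def)
    have "Re (\<phi> f) \<le> cmod (\<phi> f)" by (rule complex_Re_le_cmod)
    also have "\<dots> \<le> norm f" using dual_ball_le[OF that f] .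
    also have "\<dots> \<le> M" using M \<open>M \<ge> 0\<close> by (intro norm_le_if_rotated_eval_le) auto
    finally show "Re (\<phi> f) \<le> M" .
  qed
  then show ?thesis unfolding extremal_def by auto
qed

text \<open>Where \<open>g\<close> is close to its maximum \<open>m\<close>, compactness keeps \<open>h\<close> below \<open>M + \<delta>\<close>; elsewhere
  \<open>g - m\<close> is bounded away from \<open>0\<close>, so a large multiple of it outweighs \<open>h\<close>. Compactness is
  required only for the part of \<open>S\<close> above the level \<open>m'\<close>, so that the lemma also applies to the
  non-compact set of all rotations.\<close>

lemma penalized_bound:
  assumes S: "S \<subseteq> rotations" and m: "\<And>k. k \<in> S \<Longrightarrow> rotated_eval k g \<le> m"
    and m': "m' < m" "compact {k \<in> S. m' \<le> rotated_eval k g}"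
    and M: "\<And>k. k \<in> S \<Longrightarrow> rotated_eval k g = m \<Longrightarrow> rotated_eval k h \<le> M" and "\<delta> > 0"
  obtains t where "\<And>k. k \<in> S \<Longrightarrow> rotated_eval k h + t * (rotated_eval k g - m) \<le> M + \<delta>"
proof -
  define Q where "Q = {k \<in> S. m' \<le> rotated_eval k g} \<inter> {k. M + \<delta> \<le> rotated_eval k h}"
  have "compact Q"
    unfolding Q_def using m'(2) closed_rotated_eval_ge by (rule compact_Int_closed)
  have lt: "rotated_eval k g < m" if "k \<in> Q" for k
    using that m[of k] M[of k] \<open>\<delta> > 0\<close> by (force simp: Q_def)
  obtain m'' where m'': "m'' < m" "\<And>k. k \<in> Q \<Longrightarrow> rotated_eval k g \<le> m''"
  proof (cases "Q = {}")
    case True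
    then show ?thesis using that[of "m - 1"] by auto
  next
    case False
    obtain k\<^sub>0 where "k\<^sub>0 \<in> Q" "\<And>k. k \<in> Q \<Longrightarrow> rotated_eval k g \<le> rotated_eval k\<^sub>0 g"
      using continuous_attains_sup[OF \<open>compact Q\<close> False continuous_on_subset[OF continuous_rotated_eval]]
      by (metis subset_UNIV)
    then show ?thesis using that lt by blast
  qed
  define c where "c = max m' m''"
  define t where "t = max 0 ((norm h - M - \<delta>) / (m - c))"
  have c: "c < m" using m' m'' by (simp add: c_def)
  have "t \<ge> 0" by (simp add: t_def)
  have "rotated_eval k h + t * (rotated_eval k g - m) \<le> M + \<delta>" if k: "k \<in> S" for k
  proof (cases "rotated_eval k h \<le> M + \<delta>")
    case True
    moreover have "t * (rotated_eval k g - m) \<le> 0"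
      using \<open>t \<ge> 0\<close> m[OF k] by (simp add: mult_nonneg_nonpos)
    ultimately show ?thesis by simp
  next
    case False
    have "rotated_eval k g \<le> c"
    proof (cases "k \<in> Q")
      case True
      then show ?thesis using m''(2) by (fastforce simp: c_def)
    next
      case False
      then have "rotated_eval k g < m'"
        using k \<open>\<not> rotated_eval k h \<le> M + \<delta>\<close> by (auto simp: Q_def)
      then show ?thesis by (simp add: c_def)
    qed
    then have "t * (rotated_eval k g - m) \<le> t * (c - m)"
      using \<open>t \<ge> 0\<close> by (intro mult_left_mono) auto
    moreover have "norm h - M - \<delta> \<le> t * (m - c)"
    proof -
      have "(norm h - M - \<delta>) / (m - c) \<le> t" by (simp add: t_def)
      then show ?thesis using c by (simp add: field_simps)
    qed
    moreover have "rotated_eval k h \<le> norm h"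
      using k S by (intro rotated_eval_le_norm) auto
    ultimately show ?thesis by (simp add: algebra_simps)
  qed
  then show ?thesis by (rule that)
qed

text \<open>The set where \<open>g\<close> attains its maximum over an extremal set spans a face of that face. If a
  convex combination is dominated by it, both parts take the value \<open>m\<close> at \<open>g\<close>, and evaluating them
  at \<open>h + t g\<close> with the \<open>t\<close> from the previous lemma bounds their values at \<open>h\<close>.\<close>

lemma extremal_argmax:
  assumes S: "extremal S" and g: "g \<in> E" and m: "\<And>k. k \<in> S \<Longrightarrow> rotated_eval k g \<le> m"
    and m': "m' < m" "compact {k \<in> S. m' \<le> rotated_eval k g}"
  shows "extremal {k \<in> S. rotated_eval k g = m}" (is "extremal ?S'")
  unfolding extremal_def
proof (intro conjI ballI allI impI)
  show "?S' \<subseteq> rotations" using S by (auto simp: extremal_def)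
  fix \<phi> \<psi> t
  assume dual: "\<phi> \<in> dual_ball" "\<psi> \<in> dual_ball" and t: "0 < t" "t < (1::real)"
    and dom: "dominated ?S' (\<lambda>f. of_real (1 - t) * \<phi> f + of_real t * \<psi> f)"
  have domS: "dominated S \<phi>" "dominated S \<psi>"
    using extremalD[OF S dual t dominated_mono[OF dom]] by auto
  then have le: "Re (\<phi> g) \<le> m" "Re (\<psi> g) \<le> m"
    using g m by (auto intro!: dominatedD)
  have minus: "\<theta> (- g) = - \<theta> g" if "\<theta> \<in> dual_ball" for \<theta>
    using dual_scaleC[of \<theta> g "-1"] that g by simp
  have "Re (of_real (1 - t) * \<phi> (- g) + of_real t * \<psi> (- g)) \<le> - m"
    by (rule dominatedD[OF dom]) (auto simp: E_uminus g rotated_eval_minus)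
  then have ge: "(1 - t) * Re (\<phi> g) + t * Re (\<psi> g) \<ge> m"
    using dual by (simp add: minus)
  have "(1 - t) * Re (\<phi> g) \<le> (1 - t) * m" "t * Re (\<psi> g) \<le> t * m"
    using le t by (auto intro!: mult_left_mono)
  moreover have "(1 - t) * m + t * m = m"
    by (simp add: algebra_simps)
  ultimately have "(1 - t) * Re (\<phi> g) = (1 - t) * m" "t * Re (\<psi> g) = t * m"
    using ge by linarith+
  then have eq: "Re (\<phi> g) = m" "Re (\<psi> g) = m"
    using t by auto
  have "dominated ?S' \<theta>" if \<theta>: "\<theta> \<in> dual_ball" "dominated S \<theta>" "Re (\<theta> g) = m" for \<theta>
    unfolding dominated_def
  proof (intro ballI allI impI, rule field_le_epsilon)
    fix h M and \<delta> :: real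
    assume h: "h \<in> E" and M: "\<forall>k\<in>?S'. rotated_eval k h \<le> M" and "\<delta> > 0"
    have rot: "S \<subseteq> rotations" using S by (simp add: extremal_def)
    have M': "rotated_eval k h \<le> M" if "k \<in> S" "rotated_eval k g = m" for k
      using M that by blast
    obtain t where t: "\<And>k. k \<in> S \<Longrightarrow> rotated_eval k h + t * (rotated_eval k g - m) \<le> M + \<delta>"
      using penalized_bound[OF rot m m' M' \<open>\<delta> > 0\<close>] by blast
    have "Re (\<theta> (h + complex_of_real t *\<^sub>C g)) \<le> M + \<delta> + t * m"
      using t by (intro dominatedD[OF \<theta>(2)] E_add E_scaleC h g)
        (auto simp: rotated_eval_add rotated_eval_scale algebra_simps)
    also have "\<theta> (h + complex_of_real t *\<^sub>C g) = \<theta> h + t * \<theta> g"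
      using \<theta>(1) h g by (simp add: dual_add dual_scaleC E_scaleC)
    finally show "Re (\<theta> h) \<le> M + \<delta>"
      using \<theta>(3) by simp
  qed
  then show "dominated ?S' \<phi>" "dominated ?S' \<psi>"
    using dual domS eq by auto
qed

lemma extremal_directed_Inter:
  assumes ne: "\<S> \<noteq> {}"
    and comp: "\<And>S. S \<in> \<S> \<Longrightarrow> compact S" and ext: "\<And>S. S \<in> \<S> \<Longrightarrow> extremal S"
    and dir: "\<And>S T. S \<in> \<S> \<Longrightarrow> T \<in> \<S> \<Longrightarrow> \<exists>R\<in>\<S>. R \<subseteq> S \<inter> T"
  shows "extremal (\<Inter>\<S>)"
  unfolding extremal_def
proof (intro conjI ballI allI impI)
  show "\<Inter>\<S> \<subseteq> rotations" using ne ext by (auto simp: extremal_def)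
  fix \<phi> \<psi> t
  assume dual: "\<phi> \<in> dual_ball" "\<psi> \<in> dual_ball" and t: "0 < t" "t < (1::real)"
    and dom: "dominated (\<Inter>\<S>) (\<lambda>f. of_real (1 - t) * \<phi> f + of_real t * \<psi> f)"
  have all: "dominated S \<phi> \<and> dominated S \<psi>" if "S \<in> \<S>" for S
    using extremalD[OF ext[OF that] dual t dominated_mono[OF dom]] that by auto
  have "dominated (\<Inter>\<S>) \<theta>" if \<theta>: "\<And>S. S \<in> \<S> \<Longrightarrow> dominated S \<theta>" for \<theta>
    unfolding dominated_def
  proof (intro ballI allI impI, rule field_le_epsilon)
    fix h M and \<delta> :: real
    assume h: "h \<in> E" and M: "\<forall>k\<in>\<Inter>\<S>. rotated_eval k h \<le> M" and "\<delta> > 0"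
    have "\<Inter>\<S> \<inter> {k. M + \<delta> \<le> rotated_eval k h} = {}"
      using M \<open>\<delta> > 0\<close> by force
    then obtain S where "S \<in> \<S>" "S \<inter> {k. M + \<delta> \<le> rotated_eval k h} = {}"
      using directed_compact_Inter_nonempty[OF ne closed_rotated_eval_ge comp dir] by metis
    then show "Re (\<theta> h) \<le> M + \<delta>"
      using h by (intro dominatedD[OF \<theta>]) force+
  qed
  then show "dominated (\<Inter>\<S>) \<phi>" "dominated (\<Inter>\<S>) \<psi>"
    using all by auto
qed

text \<open>An extremal set on which every function of \<open>E\<close> has constant rotated evaluation dominates only
  one functional, which is then an extreme point; multiplication by a unimodular scalar preserves extreme points.\<close>

lemma Choquet_boundaryI:
  assumes S: "extremal S" "(\<mu>, x) \<in> S"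
    and const: "\<And>k g. k \<in> S \<Longrightarrow> g \<in> E \<Longrightarrow> rotated_eval k g = rotated_eval (\<mu>, x) g"
  shows "x \<in> Choquet_boundary E"
proof -
  let ?\<tau> = "point_evaluation E x"
  have \<mu>: "cmod \<mu> = 1"
    using S by (auto simp: extremal_def rotations_def)
  have unique: "a = ?\<tau>" if a: "a \<in> dual_ball" and dom: "dominated S (\<lambda>f. \<mu> * a f)" for a
  proof
    have Re_le: "Re (\<mu> * a g) \<le> Re (\<mu> * g x)" if "g \<in> E" for g
      using dominatedD[OF dom that, of "Re (\<mu> * g x)"] const[OF _ that]
      by (simp add: rotated_eval_def)
    have Re_eq: "Re (\<mu> * a g) = Re (\<mu> * g x)" if g: "g \<in> E" for g
      using Re_le[OF g] Re_le[OF E_scaleC[OF g, of "-1"]] dual_scaleC[of a g "-1"] a g by auto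
    fix g
    show "a g = ?\<tau> g"
    proof (cases "g \<in> E")
      case True
      have "Re (\<mu> * a (\<i> *\<^sub>C g)) = Re (\<mu> * (\<i> *\<^sub>C g) x)"
        using Re_eq[OF E_scaleC[OF True]] .
      then have "Im (\<mu> * a g) = Im (\<mu> * g x)"
        using a True by (simp add: dual_scaleC)
      then have "\<mu> * a g = \<mu> * g x"
        using Re_eq[OF True] complex_eq_iff by blast
      then show ?thesis using \<mu> True by (auto simp: point_evaluation_def)
    next
      case False
      then show ?thesis using a by (simp add: point_evaluation_def dual_outside)
    qed
  qed
  have "?\<tau> extreme_point_of dual_ball"
    unfolding extreme_point_of_def
  proof (intro conjI ballI notI)
    show "?\<tau> \<in> dual_ball" by (rule point_evaluation_dual_ball)
    fix a b assume a: "a \<in> dual_ball" and b: "b \<in> dual_ball" and "?\<tau> \<in> open_segment a b"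
    then obtain u where ab: "a \<noteq> b" and u: "0 < u" "u < 1" and eq: "?\<tau> = (1 - u) *\<^sub>R a + u *\<^sub>R b"
      by (auto simp: in_segment)
    have pt: "of_real (1 - u) * (\<mu> * a f) + of_real u * (\<mu> * b f) = \<mu> * f x" if "f \<in> E" for f
    proof -
      have "apply_bcontfun f x = of_real (1 - u) * a f + of_real u * b f"
        using fun_cong[OF eq, of f] that
        by (simp add: point_evaluation_def scaleR_fun_def scaleR_conv_of_real)
      then show ?thesis by (simp only: distrib_left mult_ac)
    qed
    have "dominated S (\<lambda>f. of_real (1 - u) * (\<mu> * a f) + of_real u * (\<mu> * b f))"
      unfolding dominated_def
    proof (intro ballI allI impI)
      fix f M assume "f \<in> E" "\<forall>k\<in>S. rotated_eval k f \<le> M"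
      then show "Re (of_real (1 - u) * (\<mu> * a f) + of_real u * (\<mu> * b f)) \<le> M"
        using S(2) pt by (force simp: rotated_eval_def)
    qed
    moreover have "(\<lambda>f. \<mu> * a f) \<in> dual_ball" "(\<lambda>f. \<mu> * b f) \<in> dual_ball"
      using a b \<mu> by (auto intro!: scaled_dual_ball[simplified])
    ultimately have "dominated S (\<lambda>f. \<mu> * a f)" "dominated S (\<lambda>f. \<mu> * b f)"
      using extremalD[OF S(1) _ _ u] by auto
    then have "a = ?\<tau>" "b = ?\<tau>"
      using unique[OF a] unique[OF b] by simp_all
    then show False using ab by simp
  qed
  then show ?thesis by (simp add: Choquet_boundary_def)
qed

text \<open>The Krein-Milman argument: by \<open>extremal_argmax\<close> a minimal compact extremal set carries constant
  evaluations.\<close>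

theorem extremal_meets_Choquet_boundary:
  assumes "compact S\<^sub>0" "S\<^sub>0 \<noteq> {}" "extremal S\<^sub>0"
  obtains \<mu> x where "(\<mu>, x) \<in> S\<^sub>0" "x \<in> Choquet_boundary E"
proof -
  define \<A> where "\<A> = {S. S \<subseteq> S\<^sub>0 \<and> compact S \<and> S \<noteq> {} \<and> extremal S}"
  \<comment> \<open>Zorn's lemma yields maximal sets; complements turn them into minimal ones.\<close>
  have "\<exists>M\<in>uminus ` \<A>. \<forall>X\<in>uminus ` \<A>. M \<subseteq> X \<longrightarrow> X = M"
  proof (rule subset_Zorn_nonempty)
    show "uminus ` \<A> \<noteq> {}" using assms by (auto simp: \<A>_def)
    fix \<C> assume "\<C> \<noteq> {}" and chain: "subset.chain (uminus ` \<A>) \<C>"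
    define \<S> where "\<S> = uminus ` \<C>"
    have \<S>: "\<S> \<noteq> {}" "\<S> \<subseteq> \<A>"
      using \<open>\<C> \<noteq> {}\<close> chain by (auto simp: \<S>_def subset.chain_def)
    have dir: "\<exists>R\<in>\<S>. R \<subseteq> S \<inter> T" if "S \<in> \<S>" "T \<in> \<S>" for S T
    proof -
      have "-S \<in> \<C>" "-T \<in> \<C>" using that by (auto simp: \<S>_def)
      then have "-S \<subseteq> -T \<or> -T \<subseteq> -S"
        using chain unfolding subset_chain_def by blast
      then have "S \<subseteq> S \<inter> T \<or> T \<subseteq> S \<inter> T" by blast
      then show ?thesis using that by blast
    qed
    have comp: "compact S" "S \<inter> UNIV \<noteq> {}" "extremal S" if "S \<in> \<S>" for S
      using that \<S> by (auto simp: \<A>_def)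
    have "\<Inter>\<S> \<noteq> {}"
      using directed_compact_Inter_nonempty[OF \<S>(1) closed_UNIV comp(1) dir comp(2)] by simp
    moreover have "extremal (\<Inter>\<S>)"
      by (rule extremal_directed_Inter[OF \<S>(1) comp(1,3) dir])
    moreover have "compact (\<Inter>\<S>)"
      using \<S>(1) comp(1) compact_Inter_t2 by blast
    moreover have "\<Inter>\<S> \<subseteq> S\<^sub>0"
      using \<S> by (auto simp: \<A>_def)
    ultimately have "\<Inter>\<S> \<in> \<A>" by (simp add: \<A>_def)
    moreover have "\<Union>\<C> = - \<Inter>\<S>" by (auto simp: \<S>_def)
    ultimately show "\<Union>\<C> \<in> uminus ` \<A>" by blast
  qed
  then obtain S where S: "S \<in> \<A>" and min: "\<And>R. R \<in> \<A> \<Longrightarrow> R \<subseteq> S \<Longrightarrow> R = S"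
    by (force simp: image_iff)
  then obtain \<mu> x where k: "(\<mu>, x) \<in> S" by (auto simp: \<A>_def)
  have const: "rotated_eval k g = rotated_eval (\<mu>, x) g" if g: "g \<in> E" and kS: "k \<in> S" for k g
  proof -
    have "compact S" "S \<noteq> {}" using S by (auto simp: \<A>_def)
    then obtain k\<^sub>0 where k0: "k\<^sub>0 \<in> S" "\<And>k. k \<in> S \<Longrightarrow> rotated_eval k g \<le> rotated_eval k\<^sub>0 g"
      using continuous_attains_sup[OF _ _ continuous_on_subset[OF continuous_rotated_eval[of g]], of S]
      by (metis subset_UNIV)
    let ?R = "{k \<in> S. rotated_eval k g = rotated_eval k\<^sub>0 g}"
    have Int: "{k \<in> S. rotated_eval k\<^sub>0 g - 1 \<le> rotated_eval k g} = S \<inter> {k. rotated_eval k\<^sub>0 g - 1 \<le> rotated_eval k g}"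
       "?R = S \<inter> {k. rotated_eval k g = rotated_eval k\<^sub>0 g}"
      by auto
    have comp: "compact {k \<in> S. rotated_eval k\<^sub>0 g - 1 \<le> rotated_eval k g}" "compact ?R"
      unfolding Int
      by (intro compact_Int_closed[OF \<open>compact S\<close>] closed_rotated_eval_ge closed_rotated_eval_eq)+
    have "extremal ?R"
      using S k0(2) by (intro extremal_argmax[OF _ g _ _ comp(1)]) (auto simp: \<A>_def)
    moreover have "?R \<noteq> {}" using k0(1) by blast
    moreover have "?R \<subseteq> S\<^sub>0" using S by (auto simp: \<A>_def)
    ultimately have "?R \<in> \<A>"
      using comp(2) by (simp add: \<A>_def)
    then have "?R = S" by (rule min) auto
    then have "k \<in> ?R" "(\<mu>, x) \<in> ?R" using k kS by simp_all
    then show ?thesis by simp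
  qed
  have "x \<in> Choquet_boundary E"
  proof (rule Choquet_boundaryI[OF _ k])
    show "extremal S" using S by (simp add: \<A>_def)
    show "rotated_eval k g = rotated_eval (\<mu>, x) g" if "k \<in> S" "g \<in> E" for k g
      using const that by blast
  qed
  then show ?thesis using that k S by (auto simp: \<A>_def)
qed

text \<open>For \<open>f\<close> of norm \<open>1\<close> these are the pairs \<open>(\<mu>, x)\<close> with \<open>\<mu> f x = 1\<close>.\<close>

definition maximizers :: "('y \<Rightarrow>\<^sub>C complex) \<Rightarrow> (complex \<times> 'y) set"
  where "maximizers f = {k \<in> rotations. rotated_eval k f = 1}"

lemma maximizers_iff:
  assumes "norm f = 1"
  shows "(\<mu>, x) \<in> maximizers f \<longleftrightarrow> cmod \<mu> = 1 \<and> f x = cnj \<mu>"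
proof -
  have "f x = cnj \<mu>" if \<mu>: "cmod \<mu> = 1" and Re: "Re (\<mu> * f x) = 1"
  proof -
    have "cmod (\<mu> * f x) \<le> 1"
      using norm_bounded[of f x] assms \<mu> by (simp add: norm_mult)
    then have "(Re (\<mu> * f x))\<^sup>2 + (Im (\<mu> * f x))\<^sup>2 \<le> 1"
      by (simp add: cmod_def)
    then have "Im (\<mu> * f x) = 0" using Re by simp
    then have "\<mu> * f x = 1" using Re by (simp add: complex_eq_iff)
    moreover have "\<mu> * cnj \<mu> = 1"
      using \<mu> complex_norm_square[of \<mu>] by simp
    ultimately show ?thesis
      by (metis mult_cancel_left mult_zero_left zero_neq_one)
  qed
  moreover have "Re (\<mu> * cnj \<mu>) = 1" if "cmod \<mu> = 1"
    using that complex_norm_square[of \<mu>] by (metis Re_complex_of_real of_real_1 power_one)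
  ultimately show ?thesis
    by (auto simp: maximizers_def rotations_def rotated_eval_def)
qed

lemma compact_superlevel:
  assumes "f \<in> C0" "\<epsilon> > 0"
  shows "compact {y. \<epsilon> \<le> cmod (f y)}"
proof -
  obtain K where K: "compact K" "\<And>y. y \<notin> K \<Longrightarrow> cmod (f y) < \<epsilon>"
    using assms by (auto simp: C0_def)
  have "closed {y. \<epsilon> \<le> cmod (f y)}"
    by (intro closed_Collect_le continuous_intros) auto
  moreover have "{y. \<epsilon> \<le> cmod (f y)} \<subseteq> K"
    using K(2) by force
  ultimately show ?thesis
    using K(1) by (metis closed_Int_compact inf.absorb1)
qed

lemma
  assumes f: "f \<in> E" "norm f = 1"
  shows compact_maximizers: "compact (maximizers f)"
    and extremal_maximizers: "extremal (maximizers f)"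
    and maximizers_nonempty: "maximizers f \<noteq> {}"
proof -
  have comp': "compact (sphere (0::complex) 1 \<times> {y. 1/2 \<le> cmod (f y)})"
    using compact_superlevel[of f "1/2"] f C0 by (intro compact_Times) auto
  have eq: "{k \<in> rotations. 1/2 \<le> rotated_eval k f}
      = (sphere 0 1 \<times> {y. 1/2 \<le> cmod (f y)}) \<inter> {k. 1/2 \<le> rotated_eval k f}"
  proof -
    have "1/2 \<le> cmod (f y)" if "cmod \<mu> = 1" "1/2 \<le> Re (\<mu> * f y)" for \<mu> y
      using that complex_Re_le_cmod[of "\<mu> * f y"] by (simp add: norm_mult)
    then show ?thesis by (auto simp: rotations_def rotated_eval_def)
  qed
  have comp: "compact {k \<in> rotations. 1/2 \<le> rotated_eval k f}"
    unfolding eq by (rule compact_Int_closed[OF comp' closed_rotated_eval_ge])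
  have eq': "maximizers f = {k \<in> rotations. 1/2 \<le> rotated_eval k f} \<inter> {k. rotated_eval k f = 1}"
    by (auto simp: maximizers_def)
  show "compact (maximizers f)"
    unfolding eq' by (rule compact_Int_closed[OF comp closed_rotated_eval_eq])
  have le: "rotated_eval k f \<le> 1" if "k \<in> rotations" for k
    using rotated_eval_le_norm[OF that, of f] f by simp
  show "extremal (maximizers f)"
    unfolding maximizers_def
    using le comp by (intro extremal_argmax[OF extremal_rotations f(1), of _ "1/2"]) auto
  show "maximizers f \<noteq> {}"
  proof
    assume empty: "maximizers f = {}"
    have ne: "{k \<in> rotations. 1/2 \<le> rotated_eval k f} \<noteq> {}"
    proof
      assume "{k \<in> rotations. 1/2 \<le> rotated_eval k f} = {}"
      then have "norm f \<le> 1/2"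
        by (intro norm_le_if_rotated_eval_le) force+
      then show False using f by simp
    qed
    obtain k\<^sub>0 where k0: "k\<^sub>0 \<in> rotations" "1/2 \<le> rotated_eval k\<^sub>0 f"
      "\<And>k. k \<in> rotations \<Longrightarrow> 1/2 \<le> rotated_eval k f \<Longrightarrow> rotated_eval k f \<le> rotated_eval k\<^sub>0 f"
      using continuous_attains_sup[OF comp ne continuous_on_subset[OF continuous_rotated_eval[of f]]]
      by blast
    have "norm f \<le> rotated_eval k\<^sub>0 f"
      using k0 by (intro norm_le_if_rotated_eval_le) force+
    then have "k\<^sub>0 \<in> maximizers f"
      using le[OF k0(1)] f k0(1) by (simp add: maximizers_def)
    then show False using empty by simp
  qed
qed

text \<open>Each set of maximizers is compact and extremal, hence so is the intersection of the directed
  family of all of them.\<close>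

lemma common_peak_value:
  assumes ne: "F \<noteq> {}" and F: "\<And>f. f \<in> F \<Longrightarrow> f \<in> E \<and> norm f = 1"
    and dir: "\<And>f g. f \<in> F \<Longrightarrow> g \<in> F \<Longrightarrow> \<exists>h\<in>F. maximizers h \<subseteq> maximizers f \<inter> maximizers g"
  obtains x \<nu> where "x \<in> Choquet_boundary E" "cmod \<nu> = 1" "\<And>f. f \<in> F \<Longrightarrow> apply_bcontfun f x = \<nu>"
proof -
  let ?\<S> = "maximizers ` F"
  have comp: "compact S" "S \<inter> UNIV \<noteq> {}" "extremal S" if "S \<in> ?\<S>" for S
    using that F compact_maximizers maximizers_nonempty extremal_maximizers by auto
  have dir': "\<exists>R\<in>?\<S>. R \<subseteq> S \<inter> T" if ST: "S \<in> ?\<S>" "T \<in> ?\<S>" for S T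
  proof -
    obtain f g where "f \<in> F" "g \<in> F" "S = maximizers f" "T = maximizers g"
      using ST by blast
    then show ?thesis using dir[of f g] by auto
  qed
  have ne': "?\<S> \<noteq> {}" using ne by simp
  have ne_Int: "\<Inter>?\<S> \<noteq> {}"
    using directed_compact_Inter_nonempty[OF ne' closed_UNIV comp(1) dir' comp(2)] by simp
  have ext: "extremal (\<Inter>?\<S>)"
    by (rule extremal_directed_Inter[OF ne' comp(1,3) dir'])
  obtain S where "S \<in> ?\<S>" using ne' by blast
  then have "compact (\<Inter>?\<S>)"
    by (rule compact_Inter_t2) (rule comp(1))
  then obtain \<mu> x where x: "(\<mu>, x) \<in> \<Inter>?\<S>" "x \<in> Choquet_boundary E"
    by (rule extremal_meets_Choquet_boundary[OF _ ne_Int ext])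
  show ?thesis
  proof (rule that[OF x(2), of "cnj \<mu>"])
    obtain f where "f \<in> F" using ne by auto
    then show "cmod (cnj \<mu>) = 1"
      using x(1) F[of f] maximizers_iff[of f \<mu> x] by auto
    show "f x = cnj \<mu>" if "f \<in> F" for f
      using x(1) F[OF that] that maximizers_iff[of f \<mu> x] by auto
  qed
qed

corollary Choquet_boundary_norming:
  assumes "f \<in> E" "norm f = 1"
  obtains x where "x \<in> Choquet_boundary E" "cmod (f x) = 1"
proof -
  have "\<exists>h\<in>{f}. maximizers h \<subseteq> maximizers g \<inter> maximizers g'" if "g \<in> {f}" "g' \<in> {f}" for g g'
    using that by auto
  then obtain x \<nu> where "x \<in> Choquet_boundary E" "cmod \<nu> = 1" "\<And>g. g \<in> {f} \<Longrightarrow> apply_bcontfun g x = \<nu>"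
    using common_peak_value[of "{f}"] assms by blast
  then show ?thesis using that by auto
qed

end

section \<open>Peak functions and faces of the sphere\<close>

locale C_regular_subspace = C0_subspace E for E :: "('y::t2_space \<Rightarrow>\<^sub>C complex) set" +
  assumes closed_E: "closed E"
    and C_regular: "extremely_C_regular E"
begin

definition face :: "'y \<Rightarrow> complex \<Rightarrow> ('y \<Rightarrow>\<^sub>C complex) set"
  where "face x c = {f \<in> unit_sphere E. apply_bcontfun f x = c}"

lemma peaking_function:
  assumes "x \<in> Choquet_boundary E" "\<epsilon> > 0" "open U" "x \<in> U"
  obtains h where "h \<in> E" "apply_bcontfun h x = 1" "norm h = 1" "\<And>y. y \<notin> U \<Longrightarrow> cmod (apply_bcontfun h y) < \<epsilon>"
  using C_regular assms unfolding extremely_C_regular_def peaks_at_def by blast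

lemma faceI:
  assumes "f \<in> E" "norm f \<le> 1" "apply_bcontfun f x = c" "cmod c = 1"
  shows "f \<in> face x c"
  using assms norm_bounded[of f x] by (auto simp: face_def unit_sphere_def)

lemma faceD:
  assumes "f \<in> face x c"
  shows "f \<in> E" "norm f = 1" "apply_bcontfun f x = c"
  using assms by (auto simp: face_def unit_sphere_def)

lemma peak_in_face:
  assumes "h \<in> E" "apply_bcontfun h x = 1" "norm h = 1" "cmod c = 1"
  shows "c *\<^sub>C h \<in> face x c"
  using assms by (intro faceI) (auto simp: E_scaleC norm_scaleC)

lemma open_near: "open {y. cmod (apply_bcontfun f y - c) < \<epsilon>}"
  by (intro open_Collect_less continuous_intros) auto

text \<open>If \<open>\<bar>b x\<bar> < 1\<close>, a multiple of a peak function works. If \<open>b x\<close> is unimodular, a peak function \<open>h\<close>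
  may take the value \<open>b x / \<mu>\<close> near \<open>x\<close>, where the sum then has modulus close to \<open>2\<close>; averaging \<open>\<mu> h\<close>
  with the rotation of \<open>b\<close> that has value \<open>\<mu>\<close> at \<open>x\<close>
  keeps the sum near \<open>x\<close> away from modulus \<open>2\<close>.\<close>

lemma face_detects_value:
  assumes x: "x \<in> Choquet_boundary E" and \<mu>: "cmod \<mu> = 1"
    and b: "b \<in> unit_sphere E" and neq: "apply_bcontfun b x \<noteq> \<mu>"
  obtains f where "f \<in> face x \<mu>" "norm (f + b) < 2"
proof -
  define \<nu> where "\<nu> = apply_bcontfun b x"
  have bE: "b \<in> E" "norm b = 1" using b by (auto simp: unit_sphere_def)
  have b_le: "cmod (apply_bcontfun b y) \<le> 1" for y
    using norm_bounded[of b y] bE by simp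
  have h_le: "cmod (apply_bcontfun h y) \<le> 1" if "norm h = 1" for h y
    using norm_bounded[of h y] that by simp
  show ?thesis
  proof (cases "cmod \<nu> < 1")
    case True
    define \<epsilon> where "\<epsilon> = (1 - cmod \<nu>) / 2"
    have "\<epsilon> > 0" using True by (simp add: \<epsilon>_def)
    then obtain h where h: "h \<in> E" "apply_bcontfun h x = 1" "norm h = 1"
      "\<And>y. y \<notin> {y. cmod (apply_bcontfun b y - \<nu>) < \<epsilon>} \<Longrightarrow> cmod (apply_bcontfun h y) < 1/2"
      using peaking_function[OF x _ open_near[of b \<nu> \<epsilon>], of "1/2"] by (auto simp: \<nu>_def)
    have "norm (\<mu> *\<^sub>C h + b) \<le> max (1 + cmod \<nu> + \<epsilon>) (3/2)"
    proof (rule norm_bound)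
      fix y
      have tri: "cmod (apply_bcontfun (\<mu> *\<^sub>C h + b) y) \<le> cmod (apply_bcontfun h y) + cmod (apply_bcontfun b y)"
        using norm_triangle_ineq[of "\<mu> * apply_bcontfun h y" "apply_bcontfun b y"] \<mu> by (simp add: norm_mult)
      show "cmod (apply_bcontfun (\<mu> *\<^sub>C h + b) y) \<le> max (1 + cmod \<nu> + \<epsilon>) (3/2)"
      proof (cases "cmod (apply_bcontfun b y - \<nu>) < \<epsilon>")
        case True
        then show ?thesis
          using tri h_le[OF h(3), of y] norm_triangle_sub[of "apply_bcontfun b y" \<nu>] by linarith
      next
        case False
        then show ?thesis
          using tri h(4)[of y] b_le[of y] by fastforce
      qed
    qed
    also have "\<dots> < 2" using True by (auto simp: \<epsilon>_def field_simps)
    finally show ?thesis using that peak_in_face[OF h(1-3) \<mu>] by blast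
  next
    case False
    then have \<nu>: "cmod \<nu> = 1" using b_le[of x] by (simp add: \<nu>_def)
    then have \<nu>': "cnj \<nu> * \<nu> = 1" using complex_norm_square[of \<nu>] by (simp add: mult.commute)
    \<comment> \<open>Equality in the triangle inequality would force \<open>\<nu> = \<mu>\<close>.\<close>
    have "cmod (\<mu>/2 + \<nu>) \<noteq> cmod (\<mu>/2) + cmod \<nu>"
      using neq \<mu> \<nu> unfolding norm_triangle_eq by (auto simp: \<nu>_def norm_divide scaleR_conv_of_real)
    then have lt: "cmod (\<mu>/2 + \<nu>) < 3/2"
      using norm_triangle_ineq[of "\<mu>/2" \<nu>] \<mu> \<nu> by (simp add: norm_divide)
    define \<gamma> where "\<gamma> = 3/2 - cmod (\<mu>/2 + \<nu>)"
    define \<rho> where "\<rho> = \<mu> * cnj \<nu>"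
    have \<rho>: "cmod \<rho> = 1" "\<rho> * \<nu> = \<mu>" using \<mu> \<nu> \<nu>' by (auto simp: \<rho>_def norm_mult mult.assoc)
    have "\<gamma> > 0" using lt by (simp add: \<gamma>_def)
    then obtain h where h: "h \<in> E" "apply_bcontfun h x = 1" "norm h = 1"
      "\<And>y. y \<notin> {y. cmod (apply_bcontfun b y - \<nu>) < \<gamma>/3} \<Longrightarrow> cmod (apply_bcontfun h y) < 1/2"
      using peaking_function[OF x _ open_near[of b \<nu> "\<gamma>/3"], of "1/2"] by (auto simp: \<nu>_def)
    define f where "f = (\<mu>/2) *\<^sub>C h + (\<rho>/2) *\<^sub>C b"
    have fE: "f \<in> E" unfolding f_def by (intro E_add E_scaleC h bE)
    have "norm f \<le> norm ((\<mu>/2) *\<^sub>C h) + norm ((\<rho>/2) *\<^sub>C b)"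
      unfolding f_def by (rule norm_triangle_ineq)
    then have "norm f \<le> 1" using h bE \<mu> \<rho> by (simp add: norm_scaleC norm_divide)
    moreover have "apply_bcontfun f x = \<mu>"
      using h \<rho> by (simp add: f_def \<nu>_def)
    ultimately have f: "f \<in> face x \<mu>" using fE \<mu> by (intro faceI)
    have "norm (f + b) \<le> max (2 - \<gamma>/2) (7/4)"
    proof (rule norm_bound)
      fix y
      let ?b = "apply_bcontfun b y" and ?h = "apply_bcontfun h y"
      have fy: "apply_bcontfun (f + b) y = (\<mu>/2) * ?h + (\<rho>/2) * ?b + ?b" by (simp add: f_def)
      show "cmod (apply_bcontfun (f + b) y) \<le> max (2 - \<gamma>/2) (7/4)"
      proof (cases "cmod (?b - \<nu>) < \<gamma>/3")
        case True
        have "apply_bcontfun (f + b) y = (\<mu>/2) * ?h + ((\<mu>/2 + \<nu>) + (\<rho>/2 + 1) * (?b - \<nu>))"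
          unfolding fy \<rho>(2)[symmetric] by (simp add: field_simps)
        also have "cmod \<dots> \<le> cmod ((\<mu>/2) * ?h) + (cmod (\<mu>/2 + \<nu>) + cmod ((\<rho>/2 + 1) * (?b - \<nu>)))"
          by (intro norm_triangle_le add_left_mono) (auto intro: norm_triangle_ineq)
        also have "cmod ((\<mu>/2) * ?h) \<le> 1/2"
          using \<mu> h_le[OF h(3), of y] by (simp add: norm_mult norm_divide)
        also have "cmod ((\<rho>/2 + 1) * (?b - \<nu>)) \<le> (3/2) * (\<gamma>/3)"
          unfolding norm_mult using True \<rho> norm_triangle_ineq[of "\<rho>/2" 1]
          by (intro mult_mono) (auto simp: norm_divide)
        finally have "cmod (apply_bcontfun (f + b) y) \<le> 2 - \<gamma>/2"
          using \<gamma>_def by linarith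
        then show ?thesis by simp
      next
        case False
        then have h2: "cmod ?h < 1/2" using h(4)[of y] by simp
        have "cmod (apply_bcontfun (f + b) y) \<le> cmod ((\<mu>/2) * ?h) + cmod ((\<rho>/2) * ?b) + cmod ?b"
          unfolding fy by (intro norm_triangle_le add_right_mono norm_triangle_ineq)
        also have "\<dots> \<le> 7/4"
          using h2 b_le[of y] \<mu> \<rho> by (simp add: norm_mult norm_divide)
        finally show ?thesis by simp
      qed
    qed
    also have "\<dots> < 2" using \<open>\<gamma> > 0\<close> by simp
    finally show ?thesis using that f by blast
  qed
qed

lemma norm_add_face:
  assumes "f \<in> face x c" "g \<in> face x c" "cmod c = 1"
  shows "norm (f + g) = 2"
proof (rule antisym)
  show "norm (f + g) \<le> 2"
    using norm_triangle_ineq[of f g] faceD[OF assms(1)] faceD[OF assms(2)] by simp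
  have "cmod (apply_bcontfun (f + g) x) = cmod (2 * c)"
    using faceD[OF assms(1)] faceD[OF assms(2)] by simp
  then show "2 \<le> norm (f + g)"
    using norm_bounded[of "f + g" x] assms(3) by (simp add: norm_mult)
qed

lemma face_subset_face:
  assumes "x \<in> Choquet_boundary E" "x' \<in> Choquet_boundary E" "cmod c = 1" "cmod c' = 1"
    and sub: "face x c \<subseteq> face x' c'"
  shows "x = x'" "c = c'"
proof -
  show xx: "x = x'"
  proof (rule ccontr)
    assume "x \<noteq> x'"
    have op: "open (- {x'})" by (intro open_Compl closed_singleton)
    obtain h where h: "h \<in> E" "apply_bcontfun h x = 1" "norm h = 1"
      "\<And>y. y \<notin> - {x'} \<Longrightarrow> cmod (apply_bcontfun h y) < 1"
      using peaking_function[OF assms(1) zero_less_one op] \<open>x \<noteq> x'\<close> by auto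
    have "c *\<^sub>C h \<in> face x' c'"
      using sub peak_in_face[OF h(1-3) assms(3)] by auto
    then have "c * apply_bcontfun h x' = c'" using faceD(3) by fastforce
    then have "cmod c' = cmod c * cmod (apply_bcontfun h x')" by (metis norm_mult)
    then show False using assms h(4)[of x'] by simp
  qed
  obtain h where h: "h \<in> E" "apply_bcontfun h x = 1" "norm h = 1"
    using peaking_function[OF assms(1) zero_less_one open_UNIV] by auto
  have "c *\<^sub>C h \<in> face x c" "c *\<^sub>C h \<in> face x' c'"
    using sub peak_in_face[OF h(1-3) assms(3)] by auto
  then show "c = c'"
    using faceD(3) xx by metis
qed

lemma weighted_peak_sum:
  fixes h :: "nat \<Rightarrow> ('y \<Rightarrow>\<^sub>C complex)"
  assumes h: "\<And>n. h n \<in> E" "\<And>n. norm (h n) = 1"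
  obtains H where "H \<in> E" "\<And>y. (\<lambda>n. (1/2)^(Suc n) * apply_bcontfun (h n) y) sums apply_bcontfun H y"
    "\<And>y. cmod (apply_bcontfun H y) \<le> (\<Sum>n. (1/2)^(Suc n) * cmod (apply_bcontfun (h n) y))"
    "\<And>y. summable (\<lambda>n. (1/2)^(Suc n) * cmod (apply_bcontfun (h n) y))"
proof -
  define p where "p n = (\<Sum>i<n. ((1/2)^(Suc i) :: complex) *\<^sub>C h i)" for n
  have pE: "p n \<in> E" for n
    unfolding p_def by (induction n) (auto intro: E_add E_scaleC h)
  have p_eq: "apply_bcontfun (p n) y = (\<Sum>i<n. (1/2)^(Suc i) * apply_bcontfun (h i) y)" for n y
    unfolding p_def by (induction n) auto
  have sm: "summable (\<lambda>n. (1/2::real)^(Suc n))"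
    using power_half_series by (rule sums_summable)
  have le: "cmod ((1/2)^(Suc n) * apply_bcontfun (h n) y) \<le> (1/2)^(Suc n)" for n y
    using norm_bounded[of "h n" y] h(2)[of n] by (simp add: norm_mult norm_power norm_divide)
  have ul: "uniform_limit UNIV (\<lambda>n y. apply_bcontfun (p n) y)
      (\<lambda>y. \<Sum>n. (1/2)^(Suc n) * apply_bcontfun (h n) y) sequentially"
    unfolding p_eq by (rule Weierstrass_m_test[OF le sm])
  then obtain H where H: "(\<lambda>y. \<Sum>n. (1/2)^(Suc n) * apply_bcontfun (h n) y) = apply_bcontfun H" "p \<longlonglongrightarrow> H"
    using uniform_limit_bcontfunE[of p _ sequentially] by auto
  have sm': "summable (\<lambda>n. cmod ((1/2)^(Suc n) * apply_bcontfun (h n) y))" for y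
    by (rule summable_comparison_test'[OF sm]) (use le in auto)
  have eq: "cmod ((1/2)^(Suc n) * apply_bcontfun (h n) y) = (1/2)^(Suc n) * cmod (apply_bcontfun (h n) y)" for n y
    by (simp add: norm_mult norm_power norm_divide)
  show ?thesis
  proof (rule that)
    show "H \<in> E" using closed_sequentially[OF closed_E pE H(2)] .
    show "(\<lambda>n. (1/2)^(Suc n) * apply_bcontfun (h n) y) sums apply_bcontfun H y" for y
      using summable_sums[OF summable_norm_cancel[OF sm'[of y]]] fun_cong[OF H(1), of y] by simp
    show "cmod (apply_bcontfun H y) \<le> (\<Sum>n. (1/2)^(Suc n) * cmod (apply_bcontfun (h n) y))" for y
      using summable_norm[OF sm'[of y]] fun_cong[OF H(1), of y] unfolding eq by simp
    show "summable (\<lambda>n. (1/2)^(Suc n) * cmod (apply_bcontfun (h n) y))" for y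
      using sm'[of y] unfolding eq .
  qed
qed

text \<open>A weighted sum of functions peaking on shrinking neighbourhoods of \<open>x\<close>. Where the oscillation of
  \<open>f\<close> is of size \<open>\<kappa> / 2 ^ n\<close>, the summands from index about \<open>n\<close> on are small and \<open>H\<close> stays below
  \<open>1\<close> by a comparable amount.\<close>

lemma refined_peaking_function:
  assumes x: "x \<in> Choquet_boundary E" and "f \<in> E" and \<kappa>: "\<kappa> > 0" and \<epsilon>: "0 < \<epsilon>" "\<epsilon> \<le> 1/2"
  obtains H where "H \<in> E" "apply_bcontfun H x = 1" "norm H = 1"
    "\<And>y. cmod (apply_bcontfun H y) \<le> \<epsilon> \<or>
      cmod (apply_bcontfun f y - apply_bcontfun f x) \<le> \<kappa> * (1 - cmod (apply_bcontfun H y))"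
proof -
  let ?e = "\<lambda>y. cmod (apply_bcontfun f y - apply_bcontfun f x)"
  \<comment> \<open>The factor \<open>1/8\<close> absorbs the index shift between \<open>U (m - 1)\<close> and the weight of the \<open>m\<close>-th
    summand, together with the bound \<open>\<epsilon> \<le> 1/2\<close>.\<close>
  define U where "U n = {y. ?e y < \<kappa> / 8 * (1/2)^n}" for n :: nat
  have "\<forall>n. \<exists>h. h \<in> E \<and> apply_bcontfun h x = 1 \<and> norm h = 1 \<and> (\<forall>y. y \<notin> U n \<longrightarrow> cmod (apply_bcontfun h y) < \<epsilon>)"
    (is "\<forall>n. \<exists>h. ?P n h")
  proof
    fix n
    have "open (U n)" unfolding U_def by (rule open_near)
    moreover have "x \<in> U n" using \<kappa> by (simp add: U_def)
    ultimately obtain h where "?P n h" using peaking_function[OF x \<epsilon>(1)] by blast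
    then show "\<exists>h. ?P n h" ..
  qed
  from choice[OF this] obtain h where "\<forall>n. h n \<in> E \<and> apply_bcontfun (h n) x = 1 \<and> norm (h n) = 1 \<and>
      (\<forall>y. y \<notin> U n \<longrightarrow> cmod (apply_bcontfun (h n) y) < \<epsilon>)"
    by blast
  then have h: "\<And>n. h n \<in> E" "\<And>n. apply_bcontfun (h n) x = 1" "\<And>n. norm (h n) = 1"
      "\<And>n y. y \<notin> U n \<Longrightarrow> cmod (apply_bcontfun (h n) y) < \<epsilon>"
    by auto
  obtain H where H: "H \<in> E" "\<And>y. (\<lambda>n. (1/2)^(Suc n) * apply_bcontfun (h n) y) sums apply_bcontfun H y"
    "\<And>y. cmod (apply_bcontfun H y) \<le> (\<Sum>n. (1/2)^(Suc n) * cmod (apply_bcontfun (h n) y))"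
    "\<And>y. summable (\<lambda>n. (1/2)^(Suc n) * cmod (apply_bcontfun (h n) y))"
    by (rule weighted_peak_sum[of h, OF h(1,3)]) blast
  have geo: "(\<lambda>n. (1/2)^(Suc n) :: real) sums 1" by (rule power_half_series)
  have geoC: "(\<lambda>n. (1/2)^(Suc n) :: complex) sums 1"
    using sums_of_real[OF geo, where 'a=complex] by simp
  have Hx: "apply_bcontfun H x = 1"
    using H(2)[of x] sums_unique2[OF geoC, of "apply_bcontfun H x"] by (simp add: h(2))
  have h_le: "cmod (apply_bcontfun (h n) y) \<le> 1" for n y
    using norm_bounded[of "h n" y] h(3)[of n] by simp
  have gap: "(\<lambda>n. (1/2)^(Suc n) * (1 - cmod (apply_bcontfun (h n) y))) sums
      (1 - (\<Sum>n. (1/2)^(Suc n) * cmod (apply_bcontfun (h n) y)))" for y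
    using sums_diff[OF geo summable_sums[OF H(4)[of y]]] by (simp only: right_diff_distrib mult_1_right)
  have gap_le: "(1/2)^(Suc n) * (1 - cmod (apply_bcontfun (h n) y)) \<le> 1 - cmod (apply_bcontfun H y)" for n y
  proof -
    have "(\<Sum>i\<in>{n}. (1/2)^(Suc i) * (1 - cmod (apply_bcontfun (h i) y)))
        \<le> (\<Sum>i. (1/2)^(Suc i) * (1 - cmod (apply_bcontfun (h i) y)))"
      using gap[of y] h_le by (intro sum_le_suminf) (auto simp: sums_iff)
    also have "\<dots> \<le> 1 - cmod (apply_bcontfun H y)"
      using gap[of y] H(3)[of y] by (simp add: sums_iff)
    finally show ?thesis by simp
  qed
  have H_le: "cmod (apply_bcontfun H y) \<le> 1" for y
  proof -
    have "0 \<le> (1/2)^(Suc 0) * (1 - cmod (apply_bcontfun (h 0) y))" using h_le by simp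
    then show ?thesis using gap_le[of 0 y] by linarith
  qed
  have "cmod (apply_bcontfun H y) \<le> \<epsilon> \<or> ?e y \<le> \<kappa> * (1 - cmod (apply_bcontfun H y))" for y
  proof (cases "?e y = 0")
    case True
    then show ?thesis using \<kappa> H_le[of y] by simp
  next
    case False
    then have "?e y > 0" by simp
    have "\<exists>n. (1/2)^n < ?e y * 8 / \<kappa>"
      using \<open>?e y > 0\<close> \<kappa> by (intro real_arch_pow_inv) auto
    then obtain n where "(1/2)^n < ?e y * 8 / \<kappa>" ..
    then have "\<kappa> / 8 * (1/2)^n < ?e y" using \<kappa> by (simp add: field_simps)
    then have ex: "\<exists>n. y \<notin> U n" by (intro exI[of _ n]) (simp add: U_def)
    \<comment> \<open>The neighbourhoods decrease, so \<open>y\<close> lies in \<open>U n\<close> exactly for \<open>n < m\<close>.\<close>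
    define m where "m = (LEAST n. y \<notin> U n)"
    have m: "y \<notin> U m" unfolding m_def using ex by (rule LeastI_ex)
    have m': "y \<in> U n" if "n < m" for n
      using not_less_Least[of n "\<lambda>n. y \<notin> U n"] that by (auto simp: m_def)
    show ?thesis
    proof (cases m)
      case 0
      have "y \<notin> U n" for n
      proof -
        have "\<kappa> / 8 * (1/2)^n \<le> \<kappa> / 8 * (1/2)^0"
          using \<kappa> by (intro mult_left_mono power_decreasing) auto
        then show ?thesis using m 0 by (auto simp: U_def)
      qed
      then have "(1/2)^(Suc n) * cmod (apply_bcontfun (h n) y) \<le> (1/2)^(Suc n) * \<epsilon>" for n
        using h(4)[of y n] by (intro mult_left_mono) auto
      then have "(\<Sum>n. (1/2)^(Suc n) * cmod (apply_bcontfun (h n) y)) \<le> (\<Sum>n. (1/2)^(Suc n) * \<epsilon>)"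
        using H(4)[of y] sums_summable[OF sums_mult2[OF geo]] by (intro suminf_le)
      also have "\<dots> = \<epsilon>" using sums_mult2[OF geo, of \<epsilon>] by (simp add: sums_iff)
      finally show ?thesis using H(3)[of y] by linarith
    next
      case (Suc k)
      have "?e y < \<kappa> / 8 * (1/2)^k" using m'[of k] Suc by (simp add: U_def)
      also have "\<dots> = \<kappa> * ((1/2)^(Suc m) * (1/2))" using Suc by simp
      also have "\<dots> \<le> \<kappa> * ((1/2)^(Suc m) * (1 - cmod (apply_bcontfun (h m) y)))"
        using \<kappa> h(4)[OF m] \<epsilon> by (intro mult_left_mono) auto
      also have "\<dots> \<le> \<kappa> * (1 - cmod (apply_bcontfun H y))"
        using \<kappa> gap_le[of m y] by (intro mult_left_mono) auto
      finally show ?thesis by simp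
    qed
  qed
  moreover have "norm H = 1"
    using norm_bounded[of H x] Hx norm_bound[of H 1, OF H_le] by simp
  ultimately show ?thesis using that[OF H(1) Hx] by blast
qed

text \<open>Adding a multiple of a peak function to \<open>f\<close> raises \<open>f x\<close> radially to the circle. The refined
  peak function compensates the oscillation of \<open>f\<close> near \<open>x\<close>, and shrinking \<open>f\<close> by \<open>1 - \<delta>\<close> first leaves
  room for the small values of the peak function away from \<open>x\<close>, so that the norm stays
  at most \<open>1\<close>.\<close>

lemma near_face:
  assumes x: "x \<in> Choquet_boundary E" and f: "f \<in> E" "norm f \<le> 1" and c: "cmod c = 1"
    and val: "apply_bcontfun f x = of_real s * c" "0 \<le> s" "s \<le> 1" and "\<eta> > 0"
  obtains g where "g \<in> face x c" "norm (f - g) \<le> 1 - s + \<eta>"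
proof -
  define \<delta> where "\<delta> = min (1/2) (\<eta>/2)"
  have \<delta>: "0 < \<delta>" "\<delta> \<le> 1/2" "\<delta> \<le> \<eta>/2" using \<open>\<eta> > 0\<close> by (auto simp: \<delta>_def)
  define s' where "s' = (1 - \<delta>) * s"
  have "s' \<le> (1 - \<delta>) * 1" unfolding s'_def using \<delta> val by (intro mult_left_mono) auto
  then have "s' \<le> 1 - \<delta>" by (simp only: mult_1_right)
  then have "s' < 1" using \<delta>(1) by simp
  moreover have "0 \<le> s'" using \<delta> val by (simp add: s'_def)
  ultimately have s': "0 \<le> s'" "s' < 1" by simp_all
  define \<kappa> where "\<kappa> = 1 - s'"
  have \<kappa>: "0 < \<kappa>" "\<kappa> \<le> 1" using s' by (auto simp: \<kappa>_def)
  define f' where "f' = of_real (1 - \<delta>) *\<^sub>C f"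
  have f'E: "f' \<in> E" by (simp add: f'_def E_scaleC f)
  have f'x: "apply_bcontfun f' x = of_real s' * c" by (simp add: f'_def val s'_def)
  have nf': "norm f' \<le> 1 - \<delta>"
  proof -
    have "norm f' = (1 - \<delta>) * norm f" using \<delta> unfolding f'_def norm_scaleC norm_of_real by simp
    also have "\<dots> \<le> (1 - \<delta>) * 1" using \<delta> f by (intro mult_left_mono) auto
    finally show ?thesis by simp
  qed
  obtain H where H: "H \<in> E" "apply_bcontfun H x = 1" "norm H = 1"
    and H_alt: "\<And>y. cmod (apply_bcontfun H y) \<le> \<delta> \<or>
      cmod (apply_bcontfun f' y - apply_bcontfun f' x) \<le> \<kappa> * (1 - cmod (apply_bcontfun H y))"
    using refined_peaking_function[OF x f'E \<kappa>(1) \<delta>(1,2)] by blast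
  define g where "g = f' + (of_real \<kappa> * c) *\<^sub>C H"
  have "norm g \<le> 1"
  proof (rule norm_bound)
    fix y
    have tri: "cmod (apply_bcontfun g y) \<le> cmod (apply_bcontfun f' y) + \<kappa> * cmod (apply_bcontfun H y)"
      using norm_triangle_ineq[of "apply_bcontfun f' y" "of_real \<kappa> * c * apply_bcontfun H y"] c \<kappa>
      by (simp add: g_def norm_mult)
    show "cmod (apply_bcontfun g y) \<le> 1"
      using H_alt[of y]
    proof
      assume H_le: "cmod (apply_bcontfun H y) \<le> \<delta>"
      have "\<kappa> * cmod (apply_bcontfun H y) \<le> 1 * \<delta>"
        using \<kappa> H_le by (intro mult_mono) auto
      then show ?thesis using tri norm_bounded[of f' y] nf' by linarith
    next
      assume "cmod (apply_bcontfun f' y - apply_bcontfun f' x) \<le> \<kappa> * (1 - cmod (apply_bcontfun H y))"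
      moreover have "cmod (apply_bcontfun f' y) \<le> cmod (apply_bcontfun f' x) + cmod (apply_bcontfun f' y - apply_bcontfun f' x)"
        by (rule norm_triangle_sub)
      moreover have "cmod (apply_bcontfun f' x) = s'" using f'x c s' by (simp add: norm_mult)
      moreover have "\<kappa> * (1 - cmod (apply_bcontfun H y)) = \<kappa> - \<kappa> * cmod (apply_bcontfun H y)"
        by (simp add: right_diff_distrib)
      ultimately show ?thesis using tri \<kappa>_def by linarith
    qed
  qed
  moreover have "apply_bcontfun g x = c"
    by (simp add: g_def f'x H \<kappa>_def algebra_simps)
  ultimately have "g \<in> face x c"
    unfolding g_def using c H f'E by (intro faceI E_add E_scaleC) auto
  moreover have "norm (f - g) \<le> 1 - s + \<eta>"
  proof -
    have "f - g = of_real \<delta> *\<^sub>C f - (of_real \<kappa> * c) *\<^sub>C H"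
      by (rule bcontfun_eqI) (simp add: g_def f'_def algebra_simps)
    then have "norm (f - g) \<le> norm (of_real \<delta> *\<^sub>C f) + norm ((of_real \<kappa> * c) *\<^sub>C H)"
      using norm_triangle_ineq4 by metis
    also have "norm (of_real \<delta> *\<^sub>C f) = \<delta> * norm f" using \<delta> by (simp add: norm_scaleC)
    also have "norm ((of_real \<kappa> * c) *\<^sub>C H) = \<kappa>" using \<kappa> c H by (simp add: norm_scaleC norm_mult)
    also have "\<delta> * norm f \<le> \<delta> * 1" using \<delta> f by (intro mult_left_mono) auto
    also have "\<kappa> = 1 - s + \<delta> * s" by (simp add: \<kappa>_def s'_def algebra_simps)
    also have "\<delta> * s \<le> \<delta> * 1" using \<delta> val by (intro mult_left_mono) auto
    finally show ?thesis using \<delta> by simp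
  qed
  ultimately show ?thesis using that by blast
qed

text \<open>Here a bare multiple of a function peaking near \<open>x\<close> is close enough, whatever the phase of \<open>c\<close>.\<close>

lemma near_opposite_face:
  assumes x: "x \<in> Choquet_boundary E" and f: "f \<in> E" "norm f \<le> 1" and c: "cmod c = 1"
    and val: "cmod (apply_bcontfun f x) = s" and "\<eta> > 0"
  obtains g where "g \<in> face x c" "norm (f - g) \<le> 1 + s + \<eta>"
proof -
  define \<nu> where "\<nu> = apply_bcontfun f x"
  have "x \<in> {y. cmod (apply_bcontfun f y - \<nu>) < \<eta>}" using \<open>\<eta> > 0\<close> by (simp add: \<nu>_def)
  then obtain h where h: "h \<in> E" "apply_bcontfun h x = 1" "norm h = 1"
    "\<And>y. y \<notin> {y. cmod (apply_bcontfun f y - \<nu>) < \<eta>} \<Longrightarrow> cmod (apply_bcontfun h y) < \<eta>"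
    using peaking_function[OF x \<open>\<eta> > 0\<close> open_near] by blast
  have "norm (f - c *\<^sub>C h) \<le> 1 + s + \<eta>"
  proof (rule norm_bound)
    fix y
    have tri: "cmod (apply_bcontfun (f - c *\<^sub>C h) y) \<le> cmod (apply_bcontfun f y) + cmod (apply_bcontfun h y)"
      using norm_triangle_ineq4[of "apply_bcontfun f y" "c * apply_bcontfun h y"] c by (simp add: norm_mult)
    have f_le: "cmod (apply_bcontfun f y) \<le> 1" and h_le: "cmod (apply_bcontfun h y) \<le> 1"
      using norm_bounded[of f y] norm_bounded[of h y] f h by simp_all
    have "s \<ge> 0" using val by auto
    show "cmod (apply_bcontfun (f - c *\<^sub>C h) y) \<le> 1 + s + \<eta>"
    proof (cases "cmod (apply_bcontfun f y - \<nu>) < \<eta>")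
      case True
      then show ?thesis
        using tri h_le norm_triangle_sub[of "apply_bcontfun f y" \<nu>] val by (simp add: \<nu>_def)
    next
      case False
      then have "cmod (apply_bcontfun h y) < \<eta>" using h(4)[of y] by simp
      then show ?thesis using tri f_le \<open>s \<ge> 0\<close> by linarith
    qed
  qed
  then show ?thesis using that peak_in_face[OF h(1-3) c] by blast
qed

end

section \<open>Support functionals of convex subsets of a sphere\<close>

definition sublinear :: "('a::real_vector \<Rightarrow> real) \<Rightarrow> bool"
  where "sublinear p \<longleftrightarrow> (\<forall>x y. p (x + y) \<le> p x + p y) \<and> (\<forall>s>0. \<forall>x. p (s *\<^sub>R x) \<le> s * p x)"

lemma sublinearD:
  assumes "sublinear p"
  shows "p (x + y) \<le> p x + p y" "s > 0 \<Longrightarrow> p (s *\<^sub>R x) \<le> s * p x"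
  using assms by (auto simp: sublinear_def)

lemma sublinear_scale:
  assumes "sublinear p" "s > 0"
  shows "p (s *\<^sub>R x) = s * p x"
proof (rule antisym)
  show "p (s *\<^sub>R x) \<le> s * p x" using assms by (rule sublinearD(2))
  have "p (inverse s *\<^sub>R s *\<^sub>R x) \<le> inverse s * p (s *\<^sub>R x)"
    using assms by (intro sublinearD(2)) auto
  then show "s * p x \<le> p (s *\<^sub>R x)" using assms(2) by (simp add: field_simps)
qed

lemma sublinear_zero: "sublinear p \<Longrightarrow> p 0 = 0"
  using sublinear_scale[of p 2 0] by simp

lemma sublinear_scale_nonneg: "sublinear p \<Longrightarrow> s \<ge> 0 \<Longrightarrow> p (s *\<^sub>R x) = s * p x"
  using sublinear_scale[of p s x] sublinear_zero[of p] by (cases "s = 0") auto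

lemma sublinear_minus: "sublinear p \<Longrightarrow> - p (- x) \<le> p x"
  using sublinearD(1)[of p x "- x"] sublinear_zero[of p] by simp

text \<open>The function \<open>x \<mapsto> inf (p (x + t c) - t k)\<close>, over \<open>t \<ge> 0\<close> and \<open>c \<in> C\<close>. It is used twice: with a
  single point \<open>C\<close> to show that minimal sublinear functions are odd, and with \<open>p\<close> the norm to
  force a functional to be at least \<open>k\<close> on \<open>C\<close>.\<close>

lemma sublinear_push_down:
  assumes p: "sublinear p" and "convex C" "C \<noteq> {}" and k: "\<And>c. c \<in> C \<Longrightarrow> k \<le> p c"
  obtains p' where "sublinear p'" "p' \<le> p" "\<And>c. c \<in> C \<Longrightarrow> p' (- c) \<le> - k"
proof -
  define V where "V x = {p (x + t *\<^sub>R c) - t * k | t c. 0 \<le> t \<and> c \<in> C}" for x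
  define p' where "p' x = Inf (V x)" for x
  have VI: "p (x + t *\<^sub>R c) - t * k \<in> V x" if "0 \<le> t" "c \<in> C" for x t c
    using that by (auto simp: V_def)
  have ne: "V x \<noteq> {}" for x using \<open>C \<noteq> {}\<close> VI[of 0] by blast
  have lower: "- p (- x) \<le> v" if v: "v \<in> V x" for x v
  proof -
    obtain t c where tc: "0 \<le> t" "c \<in> C" "v = p (x + t *\<^sub>R c) - t * k" using v by (auto simp: V_def)
    have "p (t *\<^sub>R c) \<le> p (x + t *\<^sub>R c) + p (- x)"
      using sublinearD(1)[OF p, of "x + t *\<^sub>R c" "- x"] by simp
    moreover have "t * k \<le> p (t *\<^sub>R c)"
      using tc k sublinear_scale_nonneg[OF p] by (simp add: mult_left_mono)
    ultimately show ?thesis using tc by simp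
  qed
  then have bdd: "bdd_below (V x)" for x by (rule bdd_belowI)
  have p'_le: "p' x \<le> v" if "v \<in> V x" for x v
    unfolding p'_def using that bdd by (rule cInf_lower)
  have ge_p': "z \<le> p' x" if "\<And>v. v \<in> V x \<Longrightarrow> z \<le> v" for x z
    unfolding p'_def using ne that by (rule cInf_greatest)
  have add: "p' (x + y) \<le> v + w" if v: "v \<in> V x" and w: "w \<in> V y" for x y v w
  proof -
    obtain t c where tc: "0 \<le> t" "c \<in> C" "v = p (x + t *\<^sub>R c) - t * k" using v by (auto simp: V_def)
    obtain u d where ud: "0 \<le> u" "d \<in> C" "w = p (y + u *\<^sub>R d) - u * k" using w by (auto simp: V_def)
    obtain e where e: "e \<in> C" "(t + u) *\<^sub>R e = t *\<^sub>R c + u *\<^sub>R d"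
    proof (cases "t + u = 0")
      case True
      then have "t = 0" "u = 0" using tc ud by auto
      then show ?thesis using that[OF tc(2)] by simp
    next
      case False
      have "(t / (t + u)) *\<^sub>R c + (u / (t + u)) *\<^sub>R d \<in> C"
        using False tc ud by (intro convexD[OF \<open>convex C\<close>]) (auto simp: add_divide_distrib[symmetric])
      then show ?thesis using that False by (simp add: scaleR_add_right)
    qed
    have "p' (x + y) \<le> p ((x + y) + (t + u) *\<^sub>R e) - (t + u) * k"
      using tc ud e by (intro p'_le VI) auto
    also have "(x + y) + (t + u) *\<^sub>R e = (x + t *\<^sub>R c) + (y + u *\<^sub>R d)" using e by (simp add: algebra_simps)
    also have "p \<dots> \<le> p (x + t *\<^sub>R c) + p (y + u *\<^sub>R d)" by (rule sublinearD(1)[OF p])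
    finally show ?thesis using tc ud by (simp add: algebra_simps)
  qed
  have "p' (x + y) \<le> p' x + p' y" for x y
  proof -
    have "p' (x + y) - w \<le> p' x" if "w \<in> V y" for w
      using add[OF _ that] by (intro ge_p') (simp add: algebra_simps)
    then have "p' (x + y) - p' x \<le> p' y"
      by (intro ge_p') (simp add: algebra_simps)
    then show ?thesis by simp
  qed
  moreover have "p' (s *\<^sub>R x) \<le> s * p' x" if "s > 0" for s x
  proof -
    have "inverse s * p' (s *\<^sub>R x) \<le> p' x"
    proof (rule ge_p')
      fix v assume "v \<in> V x"
      then obtain t c where tc: "0 \<le> t" "c \<in> C" "v = p (x + t *\<^sub>R c) - t * k" by (auto simp: V_def)
      have "p' (s *\<^sub>R x) \<le> p (s *\<^sub>R x + (s * t) *\<^sub>R c) - (s * t) * k"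
        using tc that by (intro p'_le VI) auto
      also have "s *\<^sub>R x + (s * t) *\<^sub>R c = s *\<^sub>R (x + t *\<^sub>R c)" by (simp add: scaleR_add_right)
      also have "p \<dots> \<le> s * p (x + t *\<^sub>R c)" using p that by (rule sublinearD(2))
      finally have "p' (s *\<^sub>R x) \<le> s * v" using tc by (simp add: right_diff_distrib mult.assoc)
      then show "inverse s * p' (s *\<^sub>R x) \<le> v" using that by (simp add: field_simps)
    qed
    then show ?thesis using that by (simp add: field_simps)
  qed
  ultimately have "sublinear p'" by (simp add: sublinear_def)
  moreover have "p' \<le> p"
  proof (rule le_funI)
    fix x
    obtain c where "c \<in> C" using \<open>C \<noteq> {}\<close> by auto
    then show "p' x \<le> p x" using p'_le[OF VI[of 0 c x]] by simp
  qed
  moreover have "p' (- c) \<le> - k" if "c \<in> C" for c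
    using p'_le[OF VI[of 1 c "- c"]] that sublinear_zero[OF p] by simp
  ultimately show ?thesis by (rule that)
qed

text \<open>Pointwise infima of chains are sublinear again, and bounded below by \<open>- p (- x)\<close>.\<close>

lemma minimal_sublinear:
  assumes "sublinear p"
  obtains m where "sublinear m" "m \<le> p" "\<And>q. sublinear q \<Longrightarrow> q \<le> m \<Longrightarrow> q = m"
proof -
  define A where "A = {q. sublinear q \<and> q \<le> p}"
  have "\<exists>m\<in>A. \<forall>q\<in>A. m \<ge> q \<longrightarrow> q = m"
  proof (rule predicate_Zorn)
    show "partial_order_on A (relation_of (\<ge>) A)"
      by (rule partial_order_on_relation_ofI) auto
    fix \<C> assume "\<C> \<in> Chains (relation_of (\<ge>) A)"
    then have CA: "\<C> \<subseteq> A" and chain: "\<And>q q'. q \<in> \<C> \<Longrightarrow> q' \<in> \<C> \<Longrightarrow> q \<le> q' \<or> q' \<le> q"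
      by (auto simp: Chains_def relation_of_def)
    show "\<exists>u\<in>A. \<forall>q\<in>\<C>. u \<le> q"
    proof (cases "\<C> = {}")
      case True
      then show ?thesis using assms by (auto simp: A_def)
    next
      case False
      define I where "I x = (INF q\<in>\<C>. q x)" for x
      have sub: "sublinear q" "q \<le> p" if "q \<in> \<C>" for q using that CA by (auto simp: A_def)
      have "- p (- x) \<le> q x" if "q \<in> \<C>" for q x
        using sublinear_minus[OF sub(1)[OF that], of x] le_funD[OF sub(2)[OF that], of "- x"] by simp
      then have bdd: "bdd_below ((\<lambda>q. q x) ` \<C>)" for x by (intro bdd_belowI2)
      have I_le: "I x \<le> q x" if "q \<in> \<C>" for q x
        unfolding I_def using bdd that by (rule cINF_lower)
      have ge_I: "z \<le> I x" if "\<And>q. q \<in> \<C> \<Longrightarrow> z \<le> q x" for x z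
        unfolding I_def using False that by (rule cINF_greatest)
      have add: "I (x + y) \<le> q x + q' y" if qq: "q \<in> \<C>" "q' \<in> \<C>" for q q' x y
      proof -
        obtain r where r: "r \<in> \<C>" "r \<le> q" "r \<le> q'" using chain[OF qq] qq by blast
        have "I (x + y) \<le> r x + r y"
          using I_le[OF r(1), of "x + y"] sublinearD(1)[OF sub(1)[OF r(1)], of x y] by simp
        then show ?thesis using le_funD[OF r(2), of x] le_funD[OF r(3), of y] by simp
      qed
      have "I (x + y) \<le> I x + I y" for x y
      proof -
        have "I (x + y) - q' y \<le> I x" if "q' \<in> \<C>" for q'
          using add[OF _ that] by (intro ge_I) (simp add: algebra_simps)
        then have "I (x + y) - I x \<le> I y" by (intro ge_I) (simp add: algebra_simps)
        then show ?thesis by simp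
      qed
      moreover have "I (s *\<^sub>R x) \<le> s * I x" if "s > 0" for s x
      proof -
        have "inverse s * I (s *\<^sub>R x) \<le> I x"
        proof (rule ge_I)
          fix q assume q: "q \<in> \<C>"
          have "I (s *\<^sub>R x) \<le> s * q x"
            using I_le[OF q, of "s *\<^sub>R x"] sublinearD(2)[OF sub(1)[OF q] that, of x] by simp
          then show "inverse s * I (s *\<^sub>R x) \<le> q x" using that by (simp add: field_simps)
        qed
        then show ?thesis using that by (simp add: field_simps)
      qed
      ultimately have "sublinear I" by (simp add: sublinear_def)
      moreover have "I \<le> q" if "q \<in> \<C>" for q using I_le[OF that] by (rule le_funI)
      moreover from this have "I \<le> p" using False sub(2) by (meson ex_in_conv order_trans)
      ultimately show ?thesis by (auto simp: A_def)
    qed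
  qed
  then obtain m where m: "m \<in> A" "\<And>q. q \<in> A \<Longrightarrow> q \<le> m \<Longrightarrow> q = m" by blast
  show ?thesis
  proof (rule that)
    show "sublinear m" "m \<le> p" using m(1) by (auto simp: A_def)
    show "q = m" if "sublinear q" "q \<le> m" for q
      using m that order_trans[of q m p] by (auto simp: A_def)
  qed
qed

text \<open>A minimal sublinear function below \<open>p\<close> is linear: pushing it down at a point cannot change it,
  so it is odd; and an odd subadditive function is additive.\<close>

lemma Hahn_Banach_sublinear:
  fixes p :: "'a::real_vector \<Rightarrow> real"
  assumes "sublinear p"
  obtains r where "linear r" "r \<le> p"
proof -
  obtain m where m: "sublinear m" "m \<le> p" and min: "\<And>q. sublinear q \<Longrightarrow> q \<le> m \<Longrightarrow> q = m"
    using minimal_sublinear[OF assms] by blast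
  have minus: "m (- a) = - m a" for a
  proof -
    obtain m' where "sublinear m'" "m' \<le> m" "\<And>c. c \<in> {a} \<Longrightarrow> m' (- c) \<le> - m a"
      using sublinear_push_down[OF m(1), of "{a}" "m a"] by blast
    then have "m (- a) \<le> - m a" using min by auto
    then show ?thesis using sublinear_minus[OF m(1), of a] by simp
  qed
  have "linear m"
  proof (rule linearI)
    fix a b
    have "m a \<le> m (a + b) + m (- b)" using sublinearD(1)[OF m(1), of "a + b" "- b"] by simp
    then show "m (a + b) = m a + m b" using sublinearD(1)[OF m(1), of a b] minus[of b] by simp
  next
    fix s a
    show "m (s *\<^sub>R a) = s *\<^sub>R m a"
    proof (cases "s \<ge> 0")
      case True
      then show ?thesis using sublinear_scale_nonneg[OF m(1)] by simp
    next
      case False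
      have "m (s *\<^sub>R a) = - m ((- s) *\<^sub>R a)" using minus[of "(- s) *\<^sub>R a"] by simp
      also have "\<dots> = s * m a" using False sublinear_scale_nonneg[OF m(1), of "- s" a] by simp
      finally show ?thesis by simp
    qed
  qed
  then show ?thesis using m that by blast
qed

text \<open>A real functional that is at most the norm everywhere and at least \<open>1\<close> on \<open>C\<close> is the real part
  of the required complex one.\<close>

theorem support_functional:
  fixes C :: "'b::complex_normed_vector set"
  assumes "convex C" "C \<noteq> {}" "\<And>c. c \<in> C \<Longrightarrow> norm c = 1"
  obtains q :: "'b \<Rightarrow> complex" where "\<And>x y. q (x + y) = q x + q y" "\<And>a x. q (a *\<^sub>C x) = a * q x"
    "\<And>x. cmod (q x) \<le> norm x" "\<And>c. c \<in> C \<Longrightarrow> q c = 1"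
proof -
  have "1 \<le> norm c" if "c \<in> C" for c using assms(3)[OF that] by simp
  moreover have "sublinear (norm :: 'b \<Rightarrow> real)"
    by (auto simp: sublinear_def norm_triangle_ineq)
  ultimately obtain p where p: "sublinear p" "p \<le> norm" "\<And>c. c \<in> C \<Longrightarrow> p (- c) \<le> - 1"
    using sublinear_push_down[OF _ assms(1,2), of norm 1] by blast
  obtain r where r: "linear r" "r \<le> p" using Hahn_Banach_sublinear[OF p(1)] by blast
  have r_le: "r x \<le> norm x" for x
    using le_funD[OF r(2), of x] le_funD[OF p(2), of x] by simp
  have r_C: "r c \<ge> 1" if "c \<in> C" for c
    using le_funD[OF r(2), of "- c"] p(3)[OF that] linear_neg[OF r(1), of c] by simp
  define q where "q x = Complex (r x) (- r (\<i> *\<^sub>C x))" for x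
  have add: "q (x + y) = q x + q y" for x y
    by (simp add: q_def linear_add[OF r(1)] scaleC_add_right complex_eq_iff)
  have scale: "q (a *\<^sub>C x) = a * q x" for a x
  proof -
    have real: "r (of_real t *\<^sub>C y) = t * r y" for t y
      using linear_cmul[OF r(1), of t y] by (simp add: scaleR_scaleC)
    have decomp: "r (a *\<^sub>C y) = Re a * r y + Im a * r (\<i> *\<^sub>C y)" for a y
    proof -
      have "a *\<^sub>C y = of_real (Re a) *\<^sub>C y + of_real (Im a) *\<^sub>C \<i> *\<^sub>C y"
        unfolding scaleC_scaleC scaleC_add_left[symmetric] by (simp add: complex_eq mult.commute)
      then show ?thesis by (simp only: linear_add[OF r(1)] real)
    qed
    show ?thesis
      using decomp[of a x] decomp[of "\<i> * a" x]
      by (simp add: q_def complex_eq_iff scaleC_scaleC)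
  qed
  have le: "cmod (q x) \<le> norm x" for x
  proof (cases "q x = 0")
    case False
    define a where "a = cnj (sgn (q x))"
    have a: "cmod a = 1" using False by (simp add: a_def norm_sgn)
    have aq: "a * q x = of_real (cmod (q x))"
      using False by (simp add: a_def sgn_eq complex_norm_square[symmetric] power2_eq_square mult.commute)
    have "cmod (q x) = r (a *\<^sub>C x)"
      using scale[of a x] aq by (metis Re_complex_of_real complex.sel(1) q_def)
    then show ?thesis using r_le[of "a *\<^sub>C x"] a by (simp add: norm_scaleC)
  qed simp
  have "q c = 1" if "c \<in> C" for c
  proof -
    have "(Re (q c))\<^sup>2 + (Im (q c))\<^sup>2 \<le> 1"
      using le[of c] assms(3)[OF that] by (simp add: cmod_def)
    moreover have "Re (q c) = 1"
      using r_C[OF that] complex_Re_le_cmod[of "q c"] le[of c] assms(3)[OF that] by (simp add: q_def)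
    ultimately show ?thesis by (simp add: complex_eq_iff)
  qed
  then show ?thesis using that[of q] add scale le by blast
qed

section \<open>Maximal convex subsets of a sphere\<close>

definition maximal_convex_in :: "'a::real_vector set \<Rightarrow> 'a set \<Rightarrow> bool"
  where "maximal_convex_in S C \<longleftrightarrow>
    convex C \<and> C \<subseteq> S \<and> (\<forall>D. convex D \<longrightarrow> C \<subseteq> D \<longrightarrow> D \<subseteq> S \<longrightarrow> D = C)"

lemma maximal_convex_exists:
  assumes "a \<in> S"
  obtains C where "maximal_convex_in S C" "a \<in> C"
proof -
  define \<A> where "\<A> = {C. convex C \<and> C \<subseteq> S \<and> a \<in> C}"
  have "\<exists>M\<in>\<A>. \<forall>X\<in>\<A>. M \<subseteq> X \<longrightarrow> X = M"
  proof (rule subset_Zorn_nonempty)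
    have "{a} \<in> \<A>" using assms by (simp add: \<A>_def)
    then show "\<A> \<noteq> {}" by blast
    fix \<C> assume ne: "\<C> \<noteq> {}" and chain: "subset.chain \<A> \<C>"
    have "convex (\<Union>\<C>)"
    proof (rule convexI)
      fix x y and u v :: real
      assume "x \<in> \<Union>\<C>" "y \<in> \<Union>\<C>" and uv: "0 \<le> u" "0 \<le> v" "u + v = 1"
      then obtain X Y where "X \<in> \<C>" "x \<in> X" "Y \<in> \<C>" "y \<in> Y" by blast
      moreover from this have "X \<subseteq> Y \<or> Y \<subseteq> X" using chain unfolding subset_chain_def by blast
      ultimately obtain Z where Z: "Z \<in> \<C>" "x \<in> Z" "y \<in> Z" by blast
      then have "convex Z" using chain unfolding subset_chain_def \<A>_def by blast
      then have "u *\<^sub>R x + v *\<^sub>R y \<in> Z" using Z uv by (intro convexD)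
      then show "u *\<^sub>R x + v *\<^sub>R y \<in> \<Union>\<C>" using Z(1) by blast
    qed
    then show "\<Union>\<C> \<in> \<A>"
      using ne chain unfolding subset_chain_def \<A>_def by blast
  qed
  then obtain M where M: "M \<in> \<A>" "\<And>X. X \<in> \<A> \<Longrightarrow> M \<subseteq> X \<Longrightarrow> X = M" by blast
  show ?thesis
  proof (rule that)
    show "a \<in> M" using M(1) by (simp add: \<A>_def)
    show "maximal_convex_in S M"
      unfolding maximal_convex_in_def
    proof (intro conjI allI impI)
      show "convex M" "M \<subseteq> S" using M(1) by (simp_all add: \<A>_def)
      fix D assume "convex D" "M \<subseteq> D" "D \<subseteq> S"
      then show "D = M" using M by (auto simp: \<A>_def)
    qed
  qed
qed

text \<open>By convexity of the norm, a chord of the unit ball whose midpoint has norm \<open>1\<close> lies in the sphere.\<close>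

lemma norm_convex_combination_eq_one:
  assumes w: "norm w = 1" "norm c = 1" "norm (w + c) = 2" and uv: "0 \<le> u" "0 \<le> v" "u + v = 1"
  shows "norm (u *\<^sub>R w + v *\<^sub>R c) = 1"
proof (rule antisym)
  show "norm (u *\<^sub>R w + v *\<^sub>R c) \<le> 1"
    using norm_triangle_ineq[of "u *\<^sub>R w" "v *\<^sub>R c"] w uv by simp
  have aux: "1 \<le> norm (u *\<^sub>R w + v *\<^sub>R c)"
    if "norm w = 1" "norm c = 1" "norm (w + c) = 2" "0 \<le> u" "u + v = 1" "v \<le> u" for w c :: 'a and u v
  proof -
    have "u *\<^sub>R w + v *\<^sub>R c = u *\<^sub>R (w + c) - (u - v) *\<^sub>R c" by (simp add: algebra_simps)
    then have "norm (u *\<^sub>R w + v *\<^sub>R c) \<ge> norm (u *\<^sub>R (w + c)) - norm ((u - v) *\<^sub>R c)"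
      by (metis norm_triangle_ineq2)
    moreover have "norm (u *\<^sub>R (w + c)) = 2 * u" "norm ((u - v) *\<^sub>R c) = u - v" using that by simp_all
    ultimately show ?thesis using that(5) by linarith
  qed
  show "1 \<le> norm (u *\<^sub>R w + v *\<^sub>R c)"
  proof (cases "v \<le> u")
    case True
    then show ?thesis using aux w uv by blast
  next
    case False
    then show ?thesis using aux[of c w v u] w uv by (simp add: add.commute)
  qed
qed

text \<open>The convex hull of \<open>C\<close> and \<open>w\<close> consists of segments from \<open>w\<close> to points of \<open>C\<close>, which stay in the
  sphere. So a maximal convex set is described by the norms of sums of two vectors, the only
  information that an isometry of spheres respects.\<close>

lemma maximal_convex_polar:
  assumes C: "maximal_convex_in (unit_sphere B) C" and B: "subspace B"
    and w: "w \<in> unit_sphere B" "\<And>c. c \<in> C \<Longrightarrow> norm (w + c) = 2"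
  shows "w \<in> C"
proof -
  have conv: "convex C" and sub: "C \<subseteq> unit_sphere B"
    and max: "\<And>D. convex D \<Longrightarrow> C \<subseteq> D \<Longrightarrow> D \<subseteq> unit_sphere B \<Longrightarrow> D = C"
    using C by (auto simp: maximal_convex_in_def)
  show ?thesis
  proof (cases "C = {}")
    case True
    then show ?thesis using max[of "{w}"] w by auto
  next
    case False
    have "convex hull (insert w C) \<subseteq> unit_sphere B"
    proof
      fix z assume "z \<in> convex hull (insert w C)"
      then obtain u v c where z: "0 \<le> u" "0 \<le> v" "u + v = 1" "c \<in> C" "z = u *\<^sub>R w + v *\<^sub>R c"
        unfolding convex_hull_insert[OF False] using hull_same[of convex C] conv by auto
      then have "norm z = 1"
        using w sub by (auto simp: unit_sphere_def intro!: norm_convex_combination_eq_one)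
      moreover have "z \<in> B"
        using z w sub B by (auto simp: unit_sphere_def intro!: subspace_add subspace_scale)
      ultimately show "z \<in> unit_sphere B" by (simp add: unit_sphere_def)
    qed
    then have "convex hull (insert w C) = C"
      using hull_subset[of "insert w C" convex] by (intro max) auto
    then show ?thesis using hull_subset[of "insert w C" convex] by auto
  qed
qed

lemma complex_subspace_imp_subspace:
  "complex_vector.subspace B \<Longrightarrow> subspace B"
  by (auto simp: complex_vector.subspace_def subspace_def scaleR_scaleC)

lemma maximal_convex_rotate:
  fixes B :: "'b::complex_normed_vector set"
  assumes C: "maximal_convex_in (unit_sphere B) C" and B: "complex_vector.subspace B" and \<mu>: "cmod \<mu> = 1"
  shows "maximal_convex_in (unit_sphere B) ((*\<^sub>C) \<mu> ` C)"
proof -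
  have linear: "linear ((*\<^sub>C) a :: 'b \<Rightarrow> 'b)" for a
    by (intro bounded_linear.linear bounded_linear_scaleC)
  have sphere: "(*\<^sub>C) a ` D \<subseteq> unit_sphere B" if "D \<subseteq> unit_sphere B" "cmod a = 1" for a D
    using that B by (auto simp: unit_sphere_def norm_scaleC complex_vector.subspace_scale)
  have "cmod (inverse \<mu>) = 1" "\<mu> \<noteq> 0" using \<mu> by (auto simp: norm_inverse)
  have cancel: "(*\<^sub>C) \<mu> ` (*\<^sub>C) (inverse \<mu>) ` D = D" "(*\<^sub>C) (inverse \<mu>) ` (*\<^sub>C) \<mu> ` D = D" for D :: "'b set"
    using \<open>\<mu> \<noteq> 0\<close> by (auto simp: image_image scaleC_scaleC scaleC_one)
  show ?thesis
    unfolding maximal_convex_in_def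
  proof (intro conjI allI impI)
    show "convex ((*\<^sub>C) \<mu> ` C)"
      using C linear by (auto simp: maximal_convex_in_def intro: convex_linear_image)
    show "(*\<^sub>C) \<mu> ` C \<subseteq> unit_sphere B"
      using C \<mu> by (intro sphere) (auto simp: maximal_convex_in_def)
    fix D assume D: "convex D" "(*\<^sub>C) \<mu> ` C \<subseteq> D" "D \<subseteq> unit_sphere B"
    have "convex ((*\<^sub>C) (inverse \<mu>) ` D)" using D linear by (auto intro: convex_linear_image)
    moreover have "C \<subseteq> (*\<^sub>C) (inverse \<mu>) ` D"
      using image_mono[OF D(2), of "(*\<^sub>C) (inverse \<mu>)"] cancel(2) by auto
    moreover have "(*\<^sub>C) (inverse \<mu>) ` D \<subseteq> unit_sphere B"
      using D(3) \<open>cmod (inverse \<mu>) = 1\<close> by (rule sphere)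
    ultimately have "(*\<^sub>C) (inverse \<mu>) ` D = C" using C by (auto simp: maximal_convex_in_def)
    then show "D = (*\<^sub>C) \<mu> ` C" using cancel(1) by metis
  qed
qed

section \<open>Preimages of maximal convex sets\<close>

lemma surj_isometryD:
  assumes "surj_isometry A B T"
  shows "x \<in> A \<Longrightarrow> T x \<in> B" "y \<in> B \<Longrightarrow> \<exists>x\<in>A. T x = y"
    "x \<in> A \<Longrightarrow> x' \<in> A \<Longrightarrow> dist (T x) (T x') = dist x x'"
  using assms by (auto simp: surj_isometry_def)

lemma unit_sphere_uminus:
  "complex_vector.subspace B \<Longrightarrow> x \<in> unit_sphere B \<Longrightarrow> - x \<in> unit_sphere B"
  by (auto simp: unit_sphere_def complex_vector.subspace_neg)

lemma norm_midpoint_eq_two: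
  fixes w c d :: "'a::real_normed_vector"
  assumes "norm w = 1" "norm c = 1" "norm d = 1" "norm (w + ((1/2) *\<^sub>R c + (1/2) *\<^sub>R d)) = 2"
  shows "norm (w + c) = 2" "norm (w + d) = 2"
proof -
  have "w + ((1/2) *\<^sub>R c + (1/2) *\<^sub>R d) = (1/2) *\<^sub>R ((w + c) + (w + d))"
    using scaleR_half_double[of w] by (simp add: scaleR_add_right)
  then have "2 = (1/2) * norm ((w + c) + (w + d))" using assms(4) by simp
  moreover have "norm ((w + c) + (w + d)) \<le> norm (w + c) + norm (w + d)" by (rule norm_triangle_ineq)
  moreover have "norm (w + c) \<le> 2" "norm (w + d) \<le> 2"
    using norm_triangle_ineq[of w c] norm_triangle_ineq[of w d] assms by simp_all
  ultimately show "norm (w + c) = 2" "norm (w + d) = 2" by linarith+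
qed

context C_regular_subspace
begin

lemma face_nonempty:
  assumes "x \<in> Choquet_boundary E" "cmod c = 1"
  obtains f where "f \<in> face x c"
proof -
  obtain h where "h \<in> E" "apply_bcontfun h x = 1" "norm h = 1"
    using peaking_function[OF assms(1) zero_less_one open_UNIV] by blast
  then show ?thesis using that peak_in_face assms(2) by blast
qed

text \<open>Write \<open>A\<close> for the left-hand side of the first inclusion. The identity \<open>\<parallel>T f - T (-a)\<parallel> = \<parallel>f + a\<parallel>\<close> turns midpoints
  in \<open>C\<close> into a directedness of \<open>A\<close>: for \<open>a1, a2 \<in> A\<close> some \<open>a \<in> A\<close> has the property that
  \<open>\<parallel>f + a\<parallel> = 2\<close> implies \<open>\<parallel>f + a1\<parallel> = \<parallel>f + a2\<parallel> = 2\<close>. By \<open>face_detects_value\<close> the three functions then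
  agree wherever \<open>\<bar>a\<bar> = 1\<close> on the Choquet boundary, and compactness gives one peak value common to
  all of \<open>A\<close>. The second inclusion follows from the first by \<open>maximal_convex_polar\<close>.\<close>

lemma face_sandwich:
  fixes B :: "'b::complex_normed_vector set"
  assumes B: "complex_vector.subspace B" and T: "surj_isometry (unit_sphere E) (unit_sphere B) T"
    and C: "maximal_convex_in (unit_sphere B) C" "C \<noteq> {}"
  obtains x c where "x \<in> Choquet_boundary E" "cmod c = 1"
    "{a \<in> unit_sphere E. - T (- a) \<in> C} \<subseteq> face x c" "face x c \<subseteq> {f \<in> unit_sphere E. T f \<in> C}"
proof -
  note TD = surj_isometryD[OF T]
  define A where "A = {a \<in> unit_sphere E. - T (- a) \<in> C}"
  have AS: "a \<in> unit_sphere E" "- T (- a) \<in> C" if "a \<in> A" for a using that by (auto simp: A_def)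
  have conv: "convex C" and CS: "C \<subseteq> unit_sphere B" using C by (auto simp: maximal_convex_in_def)
  have neg: "- f \<in> unit_sphere E" if "f \<in> unit_sphere E" for f
    using subspace that by (rule unit_sphere_uminus)
  have norm_T: "norm (T f + - T (- a)) = norm (f + a)" if "f \<in> unit_sphere E" "a \<in> unit_sphere E" for f a
    using TD(3)[OF that(1) neg[OF that(2)]] by (simp add: dist_norm)
  have C_eq: "\<exists>a\<in>A. d = - T (- a)" if "d \<in> C" for d
  proof -
    have "- d \<in> unit_sphere B" using that CS B by (auto intro: unit_sphere_uminus)
    then obtain k where k: "k \<in> unit_sphere E" "T k = - d" using TD(2) by blast
    then have "- k \<in> A" using neg[OF k(1)] that by (simp add: A_def)
    then show ?thesis using k(2) by (intro bexI[of _ "- k"]) auto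
  qed
  \<comment> \<open>A relation that is visible on both sides of \<open>T\<close>: on the side of \<open>C\<close> it is provided by midpoints,
    and for functions it will mean that \<open>b\<close> agrees with \<open>a\<close> wherever \<open>\<bar>a\<bar> = 1\<close> on the Choquet
    boundary.\<close>
  define star_le where
    "star_le a b \<longleftrightarrow> (\<forall>f\<in>unit_sphere E. norm (f + a) = 2 \<longrightarrow> norm (f + b) = 2)" for a b
  have star_dir: "\<exists>a\<in>A. star_le a a1 \<and> star_le a a2" if a12: "a1 \<in> A" "a2 \<in> A" for a1 a2
  proof -
    let ?c = "- T (- a1)" and ?d = "- T (- a2)"
    have cd: "?c \<in> C" "?d \<in> C" using a12 AS by auto
    then have "(1/2) *\<^sub>R ?c + (1/2) *\<^sub>R ?d \<in> C" using conv by (intro convexD) auto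
    then obtain a where a: "a \<in> A" "(1/2) *\<^sub>R ?c + (1/2) *\<^sub>R ?d = - T (- a)" using C_eq by blast
    have "norm (f + a1) = 2 \<and> norm (f + a2) = 2" if f: "f \<in> unit_sphere E" "norm (f + a) = 2" for f
    proof -
      have "norm (T f + ((1/2) *\<^sub>R ?c + (1/2) *\<^sub>R ?d)) = 2"
        unfolding a(2) using norm_T[OF f(1) AS(1)[OF a(1)]] f(2) by simp
      moreover have "norm (T f) = 1" "norm ?c = 1" "norm ?d = 1"
        using TD(1)[OF f(1)] cd CS by (auto simp: unit_sphere_def)
      ultimately have "norm (T f + ?c) = 2" "norm (T f + ?d) = 2"
        using norm_midpoint_eq_two by blast+
      then show ?thesis using norm_T[OF f(1)] AS(1) a12 by simp
    qed
    then show ?thesis using a(1) unfolding star_le_def by blast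
  qed
  have star_value: "apply_bcontfun b x = apply_bcontfun a x"
    if ab: "star_le a b" "a \<in> A" "b \<in> A" and ax: "x \<in> Choquet_boundary E" "cmod (apply_bcontfun a x) = 1"
    for a b x
  proof (rule ccontr)
    assume neq: "apply_bcontfun b x \<noteq> apply_bcontfun a x"
    obtain f where f: "f \<in> face x (apply_bcontfun a x)" "norm (f + b) < 2"
      using face_detects_value[OF ax AS(1)[OF ab(3)] neq] by blast
    have "a \<in> face x (apply_bcontfun a x)" using AS(1)[OF ab(2)] by (simp add: face_def)
    then have "norm (f + a) = 2" using norm_add_face[OF f(1) _ ax(2)] by blast
    then have "norm (f + b) = 2"
      using ab(1) f(1) by (simp add: star_le_def face_def)
    then show False using f(2) by simp
  qed
  \<comment> \<open>The members of \<open>A\<close> are compared on the Choquet boundary only. \<open>F\<close> is closed under midpoints,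
    whose maximizers on the whole space are exactly the common ones.\<close>
  define F where "F = {f \<in> unit_sphere E. \<exists>a\<in>A. \<forall>x\<in>Choquet_boundary E.
    cmod (apply_bcontfun a x) = 1 \<longrightarrow> apply_bcontfun f x = apply_bcontfun a x}"
  have AF: "A \<subseteq> F" using AS by (auto simp: F_def)
  have F1: "f \<in> E \<and> norm f = 1" if "f \<in> F" for f using that by (auto simp: F_def unit_sphere_def)
  have F2: "F \<noteq> {}" using C(2) C_eq AF by blast
  have F3: "\<exists>h\<in>F. maximizers h \<subseteq> maximizers f \<inter> maximizers g" if fg: "f \<in> F" "g \<in> F" for f g
  proof -
    obtain a1 where a1: "a1 \<in> A" "\<And>x. x \<in> Choquet_boundary E \<Longrightarrow> cmod (apply_bcontfun a1 x) = 1 \<Longrightarrow>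
        apply_bcontfun f x = apply_bcontfun a1 x"
      using fg(1) by (auto simp: F_def)
    obtain a2 where a2: "a2 \<in> A" "\<And>x. x \<in> Choquet_boundary E \<Longrightarrow> cmod (apply_bcontfun a2 x) = 1 \<Longrightarrow>
        apply_bcontfun g x = apply_bcontfun a2 x"
      using fg(2) by (auto simp: F_def)
    obtain a where a: "a \<in> A" "star_le a a1" "star_le a a2" using star_dir[OF a1(1) a2(1)] by blast
    define h where "h = (1/2) *\<^sub>R (f + g)"
    have hE: "h \<in> E" using F1 fg by (simp add: h_def E_scaleR E_add)
    have hval: "apply_bcontfun h x = apply_bcontfun a x"
      if x: "x \<in> Choquet_boundary E" "cmod (apply_bcontfun a x) = 1" for x
    proof -
      have "apply_bcontfun a1 x = apply_bcontfun a x" "apply_bcontfun a2 x = apply_bcontfun a x"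
        using star_value[OF a(2,1) a1(1) x] star_value[OF a(3,1) a2(1) x] by auto
      then have "apply_bcontfun f x = apply_bcontfun a x" "apply_bcontfun g x = apply_bcontfun a x"
        using a1(2)[OF x(1)] a2(2)[OF x(1)] x(2) by auto
      then show ?thesis by (simp add: h_def scaleR_conv_of_real)
    qed
    have "norm h \<le> 1" using norm_triangle_ineq[of f g] F1 fg by (simp add: h_def)
    moreover have "1 \<le> norm h"
    proof -
      have "a \<in> E" "norm a = 1" using AS(1)[OF a(1)] by (auto simp: unit_sphere_def)
      then obtain x where "x \<in> Choquet_boundary E" "cmod (apply_bcontfun a x) = 1"
        using Choquet_boundary_norming by blast
      then show ?thesis using hval norm_bounded[of h x] by simp
    qed
    ultimately have "h \<in> F" using hE a(1) hval unfolding F_def unit_sphere_def by auto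
    moreover have "maximizers h \<subseteq> maximizers f \<inter> maximizers g"
    proof
      fix k assume "k \<in> maximizers h"
      then have k: "k \<in> rotations" "rotated_eval k h = 1" by (auto simp: maximizers_def)
      have "rotated_eval k f \<le> 1" "rotated_eval k g \<le> 1"
        using rotated_eval_le_norm[OF k(1)] F1 fg by metis+
      moreover have "rotated_eval k h = (rotated_eval k f + rotated_eval k g) / 2"
        using rotated_eval_scale[of k "1/2" "f + g"]
        by (simp add: h_def scaleR_scaleC rotated_eval_add)
      ultimately show "k \<in> maximizers f \<inter> maximizers g" using k by (auto simp: maximizers_def)
    qed
    ultimately show ?thesis by blast
  qed
  obtain x c where x: "x \<in> Choquet_boundary E" and c: "cmod c = 1"
    and Fval: "\<And>f. f \<in> F \<Longrightarrow> apply_bcontfun f x = c"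
    using common_peak_value[OF F2 F1 F3] by blast
  have Aface: "A \<subseteq> face x c" using AS(1) AF Fval by (auto simp: face_def)
  have "T f \<in> C" if f: "f \<in> face x c" for f
  proof (rule maximal_convex_polar[OF C(1) complex_subspace_imp_subspace[OF B]])
    have fS: "f \<in> unit_sphere E" using f by (simp add: face_def)
    then show "T f \<in> unit_sphere B" by (rule TD(1))
    fix d assume "d \<in> C"
    then obtain a where a: "a \<in> A" "d = - T (- a)" using C_eq by blast
    then show "norm (T f + d) = 2"
      using norm_T[OF fS AS(1)[OF a(1)]] norm_add_face[OF f _ c] Aface by auto
  qed
  then have "face x c \<subseteq> {f \<in> unit_sphere E. T f \<in> C}" by (auto simp: face_def)
  then show ?thesis using that[OF x c] Aface by (simp add: A_def)
qed

text \<open>The isometry \<open>f \<mapsto> - T (- f)\<close> exchanges the two sets between which \<open>face_sandwich\<close> places a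
  face. Applying it to both isometries gives a closed chain of inclusions, because faces
  contained in one another coincide.\<close>

theorem preimage_maximal_convex:
  fixes B :: "'b::complex_normed_vector set"
  assumes B: "complex_vector.subspace B" and T: "surj_isometry (unit_sphere E) (unit_sphere B) T"
    and C: "maximal_convex_in (unit_sphere B) C" "C \<noteq> {}"
  obtains x c where "x \<in> Choquet_boundary E" "cmod c = 1"
    "{f \<in> unit_sphere E. T f \<in> C} = face x c" "\<And>f. f \<in> face x c \<Longrightarrow> - T (- f) \<in> C"
proof -
  define T' where "T' f = - T (- f)" for f
  have T': "surj_isometry (unit_sphere E) (unit_sphere B) T'"
    unfolding surj_isometry_def
  proof (intro conjI ballI)
    show "T' ` unit_sphere E = unit_sphere B"
    proof
      show "T' ` unit_sphere E \<subseteq> unit_sphere B"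
        using surj_isometryD(1)[OF T] unit_sphere_uminus[OF subspace] unit_sphere_uminus[OF B]
        by (auto simp: T'_def)
      show "unit_sphere B \<subseteq> T' ` unit_sphere E"
      proof
        fix b assume "b \<in> unit_sphere B"
        then obtain k where "k \<in> unit_sphere E" "T k = - b"
          using surj_isometryD(2)[OF T unit_sphere_uminus[OF B]] by blast
        then show "b \<in> T' ` unit_sphere E"
          using unit_sphere_uminus[OF subspace] by (intro image_eqI[of _ _ "- k"]) (auto simp: T'_def)
      qed
    qed
    show "dist (T' f) (T' g) = dist f g" if "f \<in> unit_sphere E" "g \<in> unit_sphere E" for f g
      using surj_isometryD(3)[OF T unit_sphere_uminus[OF subspace that(1)] unit_sphere_uminus[OF subspace that(2)]]
      by (simp add: T'_def dist_minus)
  qed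
  obtain x c where x: "x \<in> Choquet_boundary E" "cmod c = 1"
    and s1: "{a \<in> unit_sphere E. - T (- a) \<in> C} \<subseteq> face x c" and s2: "face x c \<subseteq> {f \<in> unit_sphere E. T f \<in> C}"
    using face_sandwich[OF B T C] by blast
  obtain x' c' where x': "x' \<in> Choquet_boundary E" "cmod c' = 1"
    and s3: "{a \<in> unit_sphere E. - T' (- a) \<in> C} \<subseteq> face x' c'" and s4: "face x' c' \<subseteq> {f \<in> unit_sphere E. T' f \<in> C}"
    using face_sandwich[OF B T' C] by blast
  have s3': "{f \<in> unit_sphere E. T f \<in> C} \<subseteq> face x' c'" using s3 by (simp add: T'_def)
  have s4': "face x' c' \<subseteq> {f \<in> unit_sphere E. - T (- f) \<in> C}" using s4 by (simp add: T'_def)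
  have "face x c \<subseteq> face x' c'" using s2 s3' by (rule order_trans)
  then have "x = x'" "c = c'" using face_subset_face[OF x(1) x'(1) x(2) x'(2)] by auto
  then have "{f \<in> unit_sphere E. T f \<in> C} = face x c" "\<And>f. f \<in> face x c \<Longrightarrow> - T (- f) \<in> C"
    using s2 s3' s4' by auto
  then show ?thesis using that[OF x] by blast
qed

end

section \<open>Isometries of the circle and tangent discs\<close>

lemma cnj_mult_self_unit: "cmod z = 1 \<Longrightarrow> z * cnj z = 1"
  by (simp add: complex_norm_square[symmetric])

lemma norm_diff_unit_squared:
  assumes "cmod a = 1" "cmod b = 1"
  shows "(cmod (a - b))\<^sup>2 = 2 - 2 * Re (a * cnj b)"
proof -
  have "(Re a)\<^sup>2 + (Im a)\<^sup>2 = 1" "(Re b)\<^sup>2 + (Im b)\<^sup>2 = 1"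
    using assms by (simp_all add: cmod_def)
  then show ?thesis unfolding cmod_power2 by (simp add: power2_eq_square algebra_simps)
qed

text \<open>Distances on the circle determine inner products, so \<open>\<rho>\<close> preserves real parts, and imaginary
  parts up to the sign in \<open>\<rho> \<i> = \<plusminus> \<i>\<close>.\<close>

lemma circle_isometry:
  assumes norm: "\<And>\<mu>. cmod \<mu> = 1 \<Longrightarrow> cmod (\<rho> \<mu>) = 1"
    and iso: "\<And>\<mu> \<nu>. cmod \<mu> = 1 \<Longrightarrow> cmod \<nu> = 1 \<Longrightarrow> cmod (\<rho> \<mu> - \<rho> \<nu>) = cmod (\<mu> - \<nu>)"
    and one: "\<rho> 1 = 1"
  shows "(\<forall>\<mu>. cmod \<mu> = 1 \<longrightarrow> \<rho> \<mu> = \<mu>) \<or> (\<forall>\<mu>. cmod \<mu> = 1 \<longrightarrow> \<rho> \<mu> = cnj \<mu>)"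
proof -
  have inner: "Re (\<rho> \<mu> * cnj (\<rho> \<nu>)) = Re (\<mu> * cnj \<nu>)" if "cmod \<mu> = 1" "cmod \<nu> = 1" for \<mu> \<nu>
    using iso[OF that] norm_diff_unit_squared[OF norm[OF that(1)] norm[OF that(2)]]
      norm_diff_unit_squared[OF that] by simp
  have Re: "Re (\<rho> \<mu>) = Re \<mu>" if "cmod \<mu> = 1" for \<mu>
    using inner[OF that, of 1] one by simp
  have "(Re (\<rho> \<i>))\<^sup>2 + (Im (\<rho> \<i>))\<^sup>2 = 1" using norm[of \<i>] by (simp add: cmod_def)
  then have "(Im (\<rho> \<i>))\<^sup>2 = 1" using Re[of \<i>] by simp
  then consider "Im (\<rho> \<i>) = 1" | "Im (\<rho> \<i>) = -1" by (auto simp: power2_eq_1_iff)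
  then show ?thesis
  proof cases
    case 1
    then have "\<rho> \<i> = \<i>" using Re[of \<i>] by (simp add: complex_eq_iff)
    then have "Im (\<rho> \<mu>) = Im \<mu>" if "cmod \<mu> = 1" for \<mu> using inner[OF that, of \<i>] by simp
    then show ?thesis using Re by (simp add: complex_eq_iff)
  next
    case 2
    then have "\<rho> \<i> = - \<i>" using Re[of \<i>] by (simp add: complex_eq_iff)
    then have "Im (\<rho> \<mu>) = - Im \<mu>" if "cmod \<mu> = 1" for \<mu> using inner[OF that, of \<i>] by simp
    then show ?thesis using Re by (simp add: complex_eq_iff)
  qed
qed

lemma tangent_discs:
  assumes "cmod (z - 1) \<le> 1 - s" "cmod (z + 1) \<le> 1 + s" "0 \<le> s"
  shows "z = of_real s"
proof -
  have Re: "s \<le> Re z" using abs_Re_le_cmod[of "z - 1"] assms(1) by simp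
  have "(cmod (z + 1))\<^sup>2 \<le> (1 + s)\<^sup>2" using assms(2) by (intro power_mono) auto
  then have le: "(Re z + 1)\<^sup>2 + (Im z)\<^sup>2 \<le> (1 + s)\<^sup>2" by (simp add: cmod_power2)
  have "(1 + s)\<^sup>2 \<le> (Re z + 1)\<^sup>2" using Re assms(3) by (intro power_mono) auto
  then have "(Im z)\<^sup>2 \<le> 0" using le by linarith
  then have Im: "Im z = 0" by simp
  have "Re z \<le> s" using abs_Re_le_cmod[of "z + 1"] assms(2) by simp
  then show ?thesis using Re Im by (simp add: complex_eq_iff)
qed

section \<open>Rotations of maximal convex sets\<close>

locale sphere_isometry = C_regular_subspace E for E :: "('y::t2_space \<Rightarrow>\<^sub>C complex) set" +
  fixes B :: "'b::complex_normed_vector set" and T :: "('y \<Rightarrow>\<^sub>C complex) \<Rightarrow> 'b"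
  assumes subspace_B: "complex_vector.subspace B"
    and T: "surj_isometry (unit_sphere E) (unit_sphere B) T"
begin

abbreviation "max_convex \<equiv> maximal_convex_in (unit_sphere B)"

text \<open>The last clause says that \<open>T\<close> maps the opposite face into \<open>-C\<close>. It stands in for oddness of
  \<open>T\<close>, which is not known at this stage.\<close>

definition preimage_face :: "'b set \<Rightarrow> 'y \<Rightarrow> complex \<Rightarrow> bool"
  where "preimage_face C x c \<longleftrightarrow> C \<subseteq> unit_sphere B \<and> x \<in> Choquet_boundary E \<and> cmod c = 1 \<and>
    {f \<in> unit_sphere E. T f \<in> C} = face x c \<and> (\<forall>f\<in>face x c. - T (- f) \<in> C)"

lemma preimage_faceD:
  assumes "preimage_face C x c"
  shows "C \<subseteq> unit_sphere B" "x \<in> Choquet_boundary E" "cmod c = 1" "f \<in> face x c \<Longrightarrow> T f \<in> C"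
    "f \<in> unit_sphere E \<Longrightarrow> T f \<in> C \<Longrightarrow> f \<in> face x c" "f \<in> face x c \<Longrightarrow> - T (- f) \<in> C"
proof -
  have eq: "{f \<in> unit_sphere E. T f \<in> C} = face x c" using assms by (simp add: preimage_face_def)
  show "f \<in> face x c \<Longrightarrow> T f \<in> C" "f \<in> unit_sphere E \<Longrightarrow> T f \<in> C \<Longrightarrow> f \<in> face x c"
    unfolding eq[symmetric] by simp_all
qed (use assms in \<open>simp_all add: preimage_face_def\<close>)

lemma preimage_face_exists:
  assumes "max_convex C" "C \<noteq> {}"
  obtains x c where "preimage_face C x c"
proof -
  obtain x c where "x \<in> Choquet_boundary E" "cmod c = 1"
    "{f \<in> unit_sphere E. T f \<in> C} = face x c" "\<And>f. f \<in> face x c \<Longrightarrow> - T (- f) \<in> C"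
    using preimage_maximal_convex[OF subspace_B T assms] by blast
  moreover have "C \<subseteq> unit_sphere B" using assms by (simp add: maximal_convex_in_def)
  ultimately have "preimage_face C x c" unfolding preimage_face_def by blast
  then show ?thesis by (rule that)
qed

lemma rotate_max_convex:
  "max_convex C \<Longrightarrow> cmod \<mu> = 1 \<Longrightarrow> max_convex ((*\<^sub>C) \<mu> ` C)"
  using maximal_convex_rotate subspace_B by blast

lemma rotate_rotate: "(*\<^sub>C) \<mu> ` (*\<^sub>C) \<nu> ` C = (*\<^sub>C) (\<mu> * \<nu>) ` C" for C :: "'b set"
  by (simp add: image_image scaleC_scaleC)

text \<open>The map \<open>v \<mapsto> \<mu> v\<close> moves every unit vector by \<open>\<bar>1 - \<mu>\<bar>\<close>, and \<open>T\<close> transports this to \<open>E\<close>.\<close>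

lemma rotate_displacement:
  assumes C: "preimage_face C x c" and C': "preimage_face ((*\<^sub>C) \<mu> ` C) x' c'" and f: "f \<in> face x c"
  shows "cmod (apply_bcontfun f x' - c') \<le> cmod (1 - \<mu>)"
proof -
  have fS: "f \<in> unit_sphere E" using f by (simp add: face_def)
  have Tf: "\<mu> *\<^sub>C T f \<in> (*\<^sub>C) \<mu> ` C" using preimage_faceD(4)[OF C f] by blast
  then have "\<mu> *\<^sub>C T f \<in> unit_sphere B" using preimage_faceD(1)[OF C'] by blast
  then obtain g where g: "g \<in> unit_sphere E" "T g = \<mu> *\<^sub>C T f" using surj_isometryD(2)[OF T] by blast
  then have gx: "apply_bcontfun g x' = c'"
    using preimage_faceD(5)[OF C' g(1)] Tf by (simp add: face_def)
  have "cmod (apply_bcontfun f x' - c') = cmod (apply_bcontfun (f - g) x')" using gx by simp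
  also have "\<dots> \<le> norm (f - g)" by (rule norm_bounded)
  also have "\<dots> = norm (T f - T g)" using surj_isometryD(3)[OF T fS g(1)] by (simp add: dist_norm)
  also have "T f - T g = (1 - \<mu>) *\<^sub>C T f"
    using complex_vector.scale_left_diff_distrib[of 1 \<mu> "T f"] by (simp add: g scaleC_one)
  also have "norm \<dots> = cmod (1 - \<mu>)"
    using surj_isometryD(1)[OF T fS] by (simp add: norm_scaleC unit_sphere_def)
  finally show ?thesis .
qed

text \<open>At a different point \<open>x'\<close>, a peak function in the face at \<open>x\<close> almost vanishes, while \<open>c'\<close> has
  modulus \<open>1\<close>. This is a displacement of almost \<open>1\<close>.\<close>

lemma preimage_face_small_rotation:
  assumes C: "preimage_face C x c" and C': "preimage_face ((*\<^sub>C) \<mu> ` C) x' c'" and \<mu>: "cmod (1 - \<mu>) < 1"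
  shows "x' = x"
proof (rule ccontr)
  assume "x' \<noteq> x"
  then have "x \<in> - {x'}" "open (- {x'})" by (auto intro: open_Compl)
  moreover have "1 - cmod (1 - \<mu>) > 0" using \<mu> by simp
  ultimately obtain h where h: "h \<in> E" "apply_bcontfun h x = 1" "norm h = 1"
    "\<And>y. y \<notin> - {x'} \<Longrightarrow> cmod (apply_bcontfun h y) < 1 - cmod (1 - \<mu>)"
    using peaking_function[OF preimage_faceD(2)[OF C]] by blast
  have "cmod (apply_bcontfun (c *\<^sub>C h) x' - c') \<le> cmod (1 - \<mu>)"
    using rotate_displacement[OF C C'] peak_in_face[OF h(1-3) preimage_faceD(3)[OF C]] by blast
  moreover have "cmod c' - cmod (apply_bcontfun (c *\<^sub>C h) x') \<le> cmod (apply_bcontfun (c *\<^sub>C h) x' - c')"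
    by (metis norm_minus_commute norm_triangle_ineq2)
  ultimately show False
    using h(4)[of x'] preimage_faceD(3)[OF C] preimage_faceD(3)[OF C'] by (simp add: norm_mult)
qed

text \<open>The principal fourth root of \<open>\<mu>\<close> is a rotation by at most 45 degrees, hence small in the sense of the
  previous lemma; four such steps make up \<open>\<mu>\<close>.\<close>

lemma preimage_face_rotation_point:
  assumes max: "max_convex C" "C \<noteq> {}"
    and C: "preimage_face C x c" and C': "preimage_face ((*\<^sub>C) \<mu> ` C) x' c'" and \<mu>: "cmod \<mu> = 1"
  shows "x' = x"
proof -
  have right: "y' = y"
    if D: "max_convex D" "D \<noteq> {}" "preimage_face D y d" "preimage_face ((*\<^sub>C) \<nu> ` D) y' d'"
      and \<nu>: "cmod \<nu> = 1" "Re \<nu> \<ge> 0" for D y d \<nu> y' d'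
  proof -
    let ?\<kappa> = "csqrt \<nu>"
    have \<kappa>: "cmod ?\<kappa> = 1" using \<nu> by simp
    have "1/2 < Re ?\<kappa>"
    proof -
      have "(1/2)\<^sup>2 < (cmod \<nu> + Re \<nu>) / 2" using \<nu> by (simp add: power2_eq_square)
      then show ?thesis unfolding csqrt.simps by (rule real_less_rsqrt)
    qed
    then have "(cmod (1 - ?\<kappa>))\<^sup>2 < 1\<^sup>2" using norm_diff_unit_squared[OF _ \<kappa>, of 1] by simp
    then have small: "cmod (1 - ?\<kappa>) < 1" by (rule power2_less_imp_less) simp
    obtain z e where z: "preimage_face ((*\<^sub>C) ?\<kappa> ` D) z e"
      using preimage_face_exists[OF rotate_max_convex[OF D(1) \<kappa>]] D(2) by blast
    have "?\<kappa> * ?\<kappa> = \<nu>" using power2_csqrt[of \<nu>] by (simp add: power2_eq_square)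
    then have "preimage_face ((*\<^sub>C) ?\<kappa> ` (*\<^sub>C) ?\<kappa> ` D) y' d'" using D(4) by (simp only: rotate_rotate)
    then show ?thesis
      using preimage_face_small_rotation[OF D(3) z small] preimage_face_small_rotation[OF z _ small] by blast
  qed
  let ?\<kappa> = "csqrt \<mu>"
  have "cmod ?\<kappa> = 1" using \<mu> by simp
  then have \<kappa>: "cmod ?\<kappa> = 1" "Re ?\<kappa> \<ge> 0" by (blast intro: Re_csqrt)+
  obtain z e where z: "preimage_face ((*\<^sub>C) ?\<kappa> ` C) z e"
    using preimage_face_exists[OF rotate_max_convex[OF max(1) \<kappa>(1)]] max(2) by blast
  have "?\<kappa> * ?\<kappa> = \<mu>" using power2_csqrt[of \<mu>] by (simp add: power2_eq_square)
  then have "preimage_face ((*\<^sub>C) ?\<kappa> ` (*\<^sub>C) ?\<kappa> ` C) x' c'" using C' by (simp only: rotate_rotate)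
  moreover have "(*\<^sub>C) ?\<kappa> ` C \<noteq> {}" using max(2) by blast
  ultimately show ?thesis
    using right[OF max C z \<kappa>] right[OF rotate_max_convex[OF max(1) \<kappa>(1)] _ z _ \<kappa>] by blast
qed

lemma preimage_face_minus:
  assumes "max_convex C" "C \<noteq> {}"
    and C: "preimage_face C x c" and C': "preimage_face ((*\<^sub>C) (-1) ` C) x' c'"
  shows "x' = x" "c' = - c"
proof -
  show x: "x' = x" using preimage_face_rotation_point[OF assms] by simp
  obtain f where f: "f \<in> face x c" using face_nonempty[OF preimage_faceD(2,3)[OF C]] by blast
  then have mf: "- f \<in> unit_sphere E" using unit_sphere_uminus[OF subspace] by (simp add: face_def)
  have "T (- f) = (-1) *\<^sub>C (- T (- f))" by (simp add: scaleC_one)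
  then have "T (- f) \<in> (*\<^sub>C) (-1) ` C" using preimage_faceD(6)[OF C f] by (rule image_eqI)
  then have "- f \<in> face x' c'" using preimage_faceD(5)[OF C' mf] by blast
  then have "apply_bcontfun (- f) x' = c'" by (rule faceD(3))
  then show "c' = - c" using x faceD(3)[OF f] by simp
qed

text \<open>The displacement bound for \<open>\<mu>\<close> and for \<open>-\<mu>\<close> gives \<open>\<bar>c - c'\<bar> \<le> \<bar>1 - \<mu>\<bar>\<close> and
  \<open>\<bar>c + c'\<bar> \<le> \<bar>1 + \<mu>\<bar>\<close>. The squares on the left add up to \<open>4\<close>, and so do those on the
  right; hence both are equalities.\<close>

lemma preimage_face_rotation_distance:
  assumes max: "max_convex C" "C \<noteq> {}"
    and C: "preimage_face C x c" and C': "preimage_face ((*\<^sub>C) \<mu> ` C) x c'" and \<mu>: "cmod \<mu> = 1"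
  shows "cmod (c - c') = cmod (1 - \<mu>)"
proof -
  have le: "cmod (d - d') \<le> cmod (1 - \<nu>)"
    if D: "preimage_face D x d" "preimage_face ((*\<^sub>C) \<nu> ` D) x d'" for D d \<nu> d'
  proof -
    obtain f where f: "f \<in> face x d" using face_nonempty[OF preimage_faceD(2,3)[OF D(1)]] by blast
    then show ?thesis using rotate_displacement[OF D f] faceD(3)[OF f] by simp
  qed
  obtain y e where "preimage_face ((*\<^sub>C) (-1) ` C) y e"
    using preimage_face_exists[OF rotate_max_convex[OF max(1), of "-1"]] max(2) by auto
  then have m: "preimage_face ((*\<^sub>C) (-1) ` C) x (- c)" using preimage_face_minus[OF max C] by metis
  have "(- \<mu>) * (-1) = \<mu>" by simp
  then have "preimage_face ((*\<^sub>C) (- \<mu>) ` (*\<^sub>C) (-1) ` C) x c'" using C' by (simp only: rotate_rotate)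
  then have "cmod (- c - c') \<le> cmod (1 - (- \<mu>))" by (rule le[OF m])
  moreover have "- 1 - \<mu> = - (1 - - \<mu>)" by simp
  ultimately have "cmod (- c - c') \<le> cmod (- 1 - \<mu>)" by (simp only: norm_minus_cancel)
  then have "(cmod (- c - c'))\<^sup>2 \<le> (cmod (- 1 - \<mu>))\<^sup>2" by (rule power_mono) simp
  moreover have "(cmod (c - c'))\<^sup>2 \<le> (cmod (1 - \<mu>))\<^sup>2" using le[OF C C'] by (intro power_mono) auto
  ultimately have "(cmod (c - c'))\<^sup>2 = (cmod (1 - \<mu>))\<^sup>2"
    using preimage_faceD(3)[OF C] preimage_faceD(3)[OF C'] \<mu> norm_diff_unit_squared[of c c'] norm_diff_unit_squared[of "-c" c']
      norm_diff_unit_squared[of 1 \<mu>] norm_diff_unit_squared[of "-1" \<mu>] by simp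
  then show ?thesis by simp
qed

lemma preimage_face_rotations:
  assumes max: "max_convex C" "C \<noteq> {}" and C: "preimage_face C x c"
  obtains \<sigma> where "\<sigma> = (\<lambda>z. z) \<or> \<sigma> = cnj"
    "\<And>\<mu>. cmod \<mu> = 1 \<Longrightarrow> preimage_face ((*\<^sub>C) \<mu> ` C) x (c * \<sigma> \<mu>)"
proof -
  have "\<exists>d. preimage_face ((*\<^sub>C) \<mu> ` C) x d" if \<mu>: "cmod \<mu> = 1" for \<mu>
  proof -
    obtain y d where "preimage_face ((*\<^sub>C) \<mu> ` C) y d"
      using preimage_face_exists[OF rotate_max_convex[OF max(1) \<mu>]] max(2) by blast
    then show ?thesis using preimage_face_rotation_point[OF max C _ \<mu>] by blast
  qed
  then obtain l where l: "\<And>\<mu>. cmod \<mu> = 1 \<Longrightarrow> preimage_face ((*\<^sub>C) \<mu> ` C) x (l \<mu>)"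
    by metis
  have c: "cmod c = 1" using preimage_faceD(3)[OF C] .
  then have c0: "c \<noteq> 0" by auto
  define \<rho> where "\<rho> \<mu> = l \<mu> / c" for \<mu>
  have dist_l: "cmod (l \<mu> - l \<nu>) = cmod (\<mu> - \<nu>)" if "cmod \<mu> = 1" "cmod \<nu> = 1" for \<mu> \<nu>
  proof -
    have "\<mu> \<noteq> 0" using that by auto
    then have "preimage_face ((*\<^sub>C) (\<nu> / \<mu>) ` (*\<^sub>C) \<mu> ` C) x (l \<nu>)" using l[OF that(2)] by (simp add: rotate_rotate)
    moreover have "cmod (\<nu> / \<mu>) = 1" using that by (simp add: norm_divide)
    moreover have "(*\<^sub>C) \<mu> ` C \<noteq> {}" using max(2) by blast
    ultimately have "cmod (l \<mu> - l \<nu>) = cmod (1 - \<nu> / \<mu>)"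
      using preimage_face_rotation_distance[OF rotate_max_convex[OF max(1) that(1)] _ l[OF that(1)]] by blast
    also have "1 - \<nu> / \<mu> = (\<mu> - \<nu>) / \<mu>" using \<open>\<mu> \<noteq> 0\<close> by (simp add: diff_divide_distrib)
    finally show ?thesis using that by (simp add: norm_divide)
  qed
  have "preimage_face ((*\<^sub>C) 1 ` C) x c" using C by (simp add: scaleC_one)
  then have "cmod (l 1 - c) = 0"
  proof -
    obtain f where "f \<in> face x (l 1)" using face_nonempty[OF preimage_faceD(2,3)[OF l[of 1]]] by auto
    then show ?thesis using rotate_displacement[OF l[of 1], of 1 x c] \<open>preimage_face ((*\<^sub>C) 1 ` C) x c\<close> faceD(3)
      by (simp add: rotate_rotate)
  qed
  then have "\<rho> 1 = 1" using c0 by (simp add: \<rho>_def)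
  moreover have "cmod (\<rho> \<mu>) = 1" if "cmod \<mu> = 1" for \<mu>
    using preimage_faceD(3)[OF l[OF that]] c by (simp add: \<rho>_def norm_divide)
  moreover have "cmod (\<rho> \<mu> - \<rho> \<nu>) = cmod (\<mu> - \<nu>)" if "cmod \<mu> = 1" "cmod \<nu> = 1" for \<mu> \<nu>
    using dist_l[OF that] c by (simp add: \<rho>_def diff_divide_distrib[symmetric] norm_divide)
  ultimately have "(\<forall>\<mu>. cmod \<mu> = 1 \<longrightarrow> \<rho> \<mu> = \<mu>) \<or> (\<forall>\<mu>. cmod \<mu> = 1 \<longrightarrow> \<rho> \<mu> = cnj \<mu>)"
    by (intro circle_isometry) auto
  moreover have "l \<mu> = c * \<rho> \<mu>" for \<mu> using c0 by (simp add: \<rho>_def)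
  ultimately show ?thesis
    using that[of "\<lambda>z. z"] that[of cnj] l by auto
qed

section \<open>Point evaluations and the radial extension\<close>

text \<open>Take \<open>C\<close> maximal convex through \<open>T a\<close>, with face \<open>(x, c)\<close> and support functional \<open>q\<close>, and let
  \<open>g x = s c'\<close> with \<open>s \<ge> 0\<close> and \<open>c' = c \<sigma> \<mu>\<close> unimodular. The faces at \<open>c'\<close> and \<open>-c'\<close> are mapped to
  \<open>\<mu> C\<close> and \<open>-\<mu> C\<close>, where \<open>q\<close> is \<open>\<mu>\<close> and \<open>-\<mu>\<close>. So \<open>q (T g)\<close> is within \<open>1 - s\<close> of \<open>\<mu>\<close> and within
  \<open>1 + s\<close> of \<open>-\<mu>\<close>, which leaves only \<open>s \<mu>\<close>; then \<open>R v = c \<sigma> (q v)\<close> is the required functional.\<close>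

theorem evaluation_via_isometry:
  assumes a: "a \<in> unit_sphere E"
  obtains x R where "cmod (apply_bcontfun a x) = 1"
    "\<And>u v. R (u + v) = R u + R v" "\<And>r v. R (r *\<^sub>R v) = of_real r * R v"
    "\<And>g. g \<in> unit_sphere E \<Longrightarrow> apply_bcontfun g x = R (T g)"
proof -
  obtain C where C: "max_convex C" "T a \<in> C"
    using maximal_convex_exists surj_isometryD(1)[OF T a] by blast
  then have ne: "C \<noteq> {}" by blast
  obtain x c where xc: "preimage_face C x c" using preimage_face_exists[OF C(1) ne] by blast
  have x: "x \<in> Choquet_boundary E" and c: "cmod c = 1" using preimage_faceD[OF xc] by auto
  then have c0: "c \<noteq> 0" by auto
  obtain \<sigma> where \<sigma>: "\<sigma> = (\<lambda>z. z) \<or> \<sigma> = cnj"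
    and rot: "\<And>\<mu>. cmod \<mu> = 1 \<Longrightarrow> preimage_face ((*\<^sub>C) \<mu> ` C) x (c * \<sigma> \<mu>)"
    using preimage_face_rotations[OF C(1) ne xc] by blast
  have \<sigma>_props: "\<sigma> (u + v) = \<sigma> u + \<sigma> v" "\<sigma> (of_real r * u) = of_real r * \<sigma> u" "\<sigma> (\<sigma> u) = u"
    "cmod (\<sigma> u) = cmod u" "\<sigma> (- u) = - \<sigma> u" for u v r
    using \<sigma> by auto
  have "convex C" and C1: "\<And>d. d \<in> C \<Longrightarrow> norm d = 1"
    using C(1) by (auto simp: maximal_convex_in_def unit_sphere_def)
  then obtain q where q: "\<And>u v. q (u + v) = q u + q v" "\<And>z u. q (z *\<^sub>C u) = z * q u"
    "\<And>u. cmod (q u) \<le> norm u" "\<And>d. d \<in> C \<Longrightarrow> q d = 1"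
    using support_functional[of C] ne by blast
  have q_diff: "q (u - v) = q u - q v" for u v
    using q(1)[of u "(-1) *\<^sub>C v"] q(2)[of "-1" v] by simp
  have q_face: "q (T f) = \<mu>" if "cmod \<mu> = 1" "f \<in> face x (c * \<sigma> \<mu>)" for f \<mu>
    using preimage_faceD(4)[OF rot[OF that(1)] that(2)] q(2,4) by auto
  have q_T: "cmod (q (T g) - \<mu>) \<le> norm (g - f)"
    if "cmod \<mu> = 1" "f \<in> face x (c * \<sigma> \<mu>)" "g \<in> unit_sphere E" for f g \<mu>
  proof -
    have f: "f \<in> unit_sphere E" using that(2) by (simp add: face_def)
    have "cmod (q (T g) - \<mu>) = cmod (q (T g - T f))" using q_face[OF that(1,2)] by (simp add: q_diff)
    also have "\<dots> \<le> norm (T g - T f)" by (rule q(3))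
    also have "\<dots> = norm (g - f)" using surj_isometryD(3)[OF T that(3) f] by (simp add: dist_norm)
    finally show ?thesis .
  qed
  have g_value: "apply_bcontfun g x = c * \<sigma> (q (T g))" if g: "g \<in> unit_sphere E" for g
  proof -
    have gE: "g \<in> E" "norm g \<le> 1" using g by (auto simp: unit_sphere_def)
    define s where "s = cmod (apply_bcontfun g x)"
    have s: "0 \<le> s" "s \<le> 1" using norm_bounded[of g x] gE by (auto simp: s_def)
    obtain c' where c': "cmod c' = 1" "apply_bcontfun g x = of_real s * c'"
    proof (cases "apply_bcontfun g x = 0")
      case True
      then show ?thesis using that[OF c] by (simp add: s_def)
    next
      case False
      then have "cmod (sgn (apply_bcontfun g x)) = 1" by (simp add: norm_sgn)
      moreover have "apply_bcontfun g x = of_real s * sgn (apply_bcontfun g x)"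
        using False by (simp add: s_def sgn_eq)
      ultimately show ?thesis by (rule that)
    qed
    \<comment> \<open>\<open>\<sigma>\<close> is its own inverse, so this solves \<open>c \<sigma> \<mu> = c'\<close>.\<close>
    define \<mu> where "\<mu> = \<sigma> (c' / c)"
    have \<mu>: "cmod \<mu> = 1" "c * \<sigma> \<mu> = c'" using c c' c0 by (auto simp: \<mu>_def \<sigma>_props norm_divide)
    have near: "cmod (q (T g) - \<mu>) \<le> 1 - s"
    proof (rule field_le_epsilon)
      fix \<eta> :: real assume "\<eta> > 0"
      then obtain f where "f \<in> face x c'" "norm (g - f) \<le> 1 - s + \<eta>"
        using near_face[OF x gE c'(1,2) s] by blast
      then show "cmod (q (T g) - \<mu>) \<le> 1 - s + \<eta>" using q_T[OF \<mu>(1) _ g] \<mu>(2) order_trans by metis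
    qed
    have far: "cmod (q (T g) - - \<mu>) \<le> 1 + s"
    proof (rule field_le_epsilon)
      fix \<eta> :: real assume "\<eta> > 0"
      moreover have "cmod (- c') = 1" using c' by simp
      ultimately obtain f where "f \<in> face x (- c')" "norm (g - f) \<le> 1 + s + \<eta>"
        using near_opposite_face[OF x gE _ s_def[symmetric]] by blast
      moreover have "c * \<sigma> (- \<mu>) = - c'" "cmod (- \<mu>) = 1" using \<mu> by (simp_all add: \<sigma>_props)
      ultimately show "cmod (q (T g) - - \<mu>) \<le> 1 + s + \<eta>" using q_T[of "- \<mu>" f g] g by simp
    qed
    define z where "z = q (T g) * cnj \<mu>"
    have \<mu>\<mu>: "\<mu> * cnj \<mu> = 1" using cnj_mult_self_unit[OF \<mu>(1)] .
    have "z - 1 = (q (T g) - \<mu>) * cnj \<mu>" "z + 1 = (q (T g) - - \<mu>) * cnj \<mu>"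
      using \<mu>\<mu> by (simp_all add: z_def algebra_simps)
    then have "cmod (z - 1) \<le> 1 - s" "cmod (z + 1) \<le> 1 + s"
      using near far \<mu>(1) by (simp_all add: norm_mult)
    then have "z = of_real s" using s by (intro tangent_discs)
    moreover have "q (T g) = z * \<mu>" using \<mu>\<mu> by (simp add: z_def mult.assoc mult.commute[of "cnj \<mu>"])
    ultimately show ?thesis using \<mu>(2) c' by (simp add: \<sigma>_props)
  qed
  show ?thesis
  proof (rule that)
    have "a \<in> face x c" using preimage_faceD(5)[OF xc a C(2)] .
    then show "cmod (apply_bcontfun a x) = 1" using c by (simp add: face_def)
    show "apply_bcontfun g x = (\<lambda>v. c * \<sigma> (q v)) (T g)" if "g \<in> unit_sphere E" for g
      using g_value[OF that] by simp
    show "(\<lambda>v. c * \<sigma> (q v)) (u + v) = (\<lambda>v. c * \<sigma> (q v)) u + (\<lambda>v. c * \<sigma> (q v)) v" for u v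
      by (simp add: q \<sigma>_props distrib_left)
    show "(\<lambda>v. c * \<sigma> (q v)) (r *\<^sub>R v) = of_real r * (\<lambda>v. c * \<sigma> (q v)) v" for r v
      by (simp add: scaleR_scaleC q \<sigma>_props)
  qed
qed

end

context sphere_isometry
begin

text \<open>At \<open>0\<close> the factor \<open>norm f\<close> makes the value \<open>0\<close>, although \<open>T 0\<close> is arbitrary.\<close>

definition radial_extension :: "('y \<Rightarrow>\<^sub>C complex) \<Rightarrow> 'b"
  where "radial_extension f = norm f *\<^sub>R T (inverse (norm f) *\<^sub>R f)"

lemma normalized_in_sphere:
  assumes "f \<in> E" "f \<noteq> 0"
  shows "inverse (norm f) *\<^sub>R f \<in> unit_sphere E"
  using assms by (simp add: unit_sphere_def E_scaleR)

lemma radial_extension_in: "f \<in> E \<Longrightarrow> radial_extension f \<in> B"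
  using complex_vector.subspace_0[OF subspace_B]
    surj_isometryD(1)[OF T normalized_in_sphere[of f]] subspace_scale[OF complex_subspace_imp_subspace[OF subspace_B]]
  by (cases "f = 0") (auto simp: radial_extension_def unit_sphere_def)

lemma norm_radial_extension: "f \<in> E \<Longrightarrow> norm (radial_extension f) = norm f"
  using surj_isometryD(1)[OF T normalized_in_sphere[of f]]
  by (cases "f = 0") (auto simp: radial_extension_def unit_sphere_def)

text \<open>If \<open>d \<noteq> 0\<close>, its normalization is \<open>T k\<close> for some \<open>k\<close>, and the functional recovering evaluation at
  a suitable peak point of \<open>k\<close> does not vanish at \<open>d\<close>.\<close>

lemma vanishes_if_evaluations_vanish:
  assumes d: "d \<in> B" and zero: "\<And>R x. \<lbrakk>\<And>u v. R (u + v) = R u + R v; \<And>r v. R (r *\<^sub>R v) = of_real r * R v;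
      \<And>f. f \<in> E \<Longrightarrow> R (radial_extension f) = apply_bcontfun f x\<rbrakk> \<Longrightarrow> R d = (0::complex)"
  shows "d = 0"
proof (rule ccontr)
  assume "d \<noteq> 0"
  then have "inverse (norm d) *\<^sub>R d \<in> unit_sphere B"
    using d subspace_scale[OF complex_subspace_imp_subspace[OF subspace_B]] by (simp add: unit_sphere_def)
  then obtain k where k: "k \<in> unit_sphere E" "T k = inverse (norm d) *\<^sub>R d"
    using surj_isometryD(2)[OF T] by blast
  obtain x R where x: "cmod (apply_bcontfun k x) = 1"
    and add: "\<And>u v. R (u + v) = R u + R v" and scale: "\<And>r v. R (r *\<^sub>R v) = of_real r * R v"
    and ev: "\<And>g. g \<in> unit_sphere E \<Longrightarrow> apply_bcontfun g x = R (T g)"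
    using evaluation_via_isometry[OF k(1)] by blast
  have "R (radial_extension f) = apply_bcontfun f x" if "f \<in> E" for f
  proof (cases "f = 0")
    case True
    then show ?thesis using scale[of 0 0] by (simp add: radial_extension_def)
  next
    case False
    have "R (T (inverse (norm f) *\<^sub>R f)) = inverse (of_real (norm f)) * apply_bcontfun f x"
      using ev[OF normalized_in_sphere[OF that False]] by (simp add: scaleR_conv_of_real)
    then show ?thesis using False by (simp add: radial_extension_def scale)
  qed
  then have "R d = 0" using zero add scale by blast
  then have "apply_bcontfun k x = 0" using ev[OF k(1)] k(2) scale by simp
  then show False using x by simp
qed

lemma radial_extension_add:
  assumes "f \<in> E" "g \<in> E"
  shows "radial_extension (f + g) = radial_extension f + radial_extension g"
proof -
  let ?d = "radial_extension (f + g) - radial_extension f - radial_extension g"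
  have "?d \<in> B"
    using assms by (intro complex_vector.subspace_diff[OF subspace_B] radial_extension_in E_add)
  moreover have "R ?d = 0" if R: "\<And>u v. R (u + v) = R u + R v"
      "\<And>f. f \<in> E \<Longrightarrow> R (radial_extension f) = apply_bcontfun f x" for R :: "'b \<Rightarrow> complex" and x
  proof -
    have R_diff: "R (u - v) = R u - R v" for u v using R(1)[of "u - v" v] by simp
    show ?thesis using R(2)[OF E_add[OF assms]] R(2)[OF assms(1)] R(2)[OF assms(2)] by (simp add: R_diff)
  qed
  ultimately have "?d = 0" by (rule vanishes_if_evaluations_vanish)
  then show ?thesis by (simp add: algebra_simps)
qed

lemma radial_extension_scale:
  assumes "f \<in> E"
  shows "radial_extension (r *\<^sub>R f) = r *\<^sub>R radial_extension f"
proof -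
  let ?d = "radial_extension (r *\<^sub>R f) - r *\<^sub>R radial_extension f"
  have "?d \<in> B"
    using assms subspace_scale[OF complex_subspace_imp_subspace[OF subspace_B]]
    by (intro complex_vector.subspace_diff[OF subspace_B] radial_extension_in E_scaleR) (auto intro: radial_extension_in)
  moreover have "R ?d = 0" if R: "\<And>u v. R (u + v) = R u + R v" "\<And>r v. R (r *\<^sub>R v) = of_real r * R v"
      "\<And>f. f \<in> E \<Longrightarrow> R (radial_extension f) = apply_bcontfun f x" for R :: "'b \<Rightarrow> complex" and x
  proof -
    have R_diff: "R (u - v) = R u - R v" for u v using R(1)[of "u - v" v] by simp
    show ?thesis using R(3)[OF E_scaleR[OF assms, of r]] R(3)[OF assms]
      by (simp add: R_diff R(2) scaleR_conv_of_real)
  qed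
  ultimately have "?d = 0" by (rule vanishes_if_evaluations_vanish)
  then show ?thesis by simp
qed

theorem radial_extension_isometry:
  "real_linear_on E radial_extension" "surj_isometry E B radial_extension"
  "\<And>f. f \<in> unit_sphere E \<Longrightarrow> radial_extension f = T f"
proof -
  show "real_linear_on E radial_extension"
    unfolding real_linear_on_def using radial_extension_add radial_extension_scale by blast
  show ext: "radial_extension f = T f" if "f \<in> unit_sphere E" for f
    using that by (simp add: radial_extension_def unit_sphere_def)
  have diff: "radial_extension (f - g) = radial_extension f - radial_extension g" if "f \<in> E" "g \<in> E" for f g
    using radial_extension_add[OF E_diff[OF that] that(2)] by simp
  have "b \<in> radial_extension ` E" if b: "b \<in> B" for b
  proof (cases "b = 0")
    case True
    then show ?thesis using E_zero by (intro image_eqI[of _ _ 0]) (simp_all add: radial_extension_def)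
  next
    case False
    then have "inverse (norm b) *\<^sub>R b \<in> unit_sphere B"
      using b subspace_scale[OF complex_subspace_imp_subspace[OF subspace_B]] by (simp add: unit_sphere_def)
    then obtain k where k: "k \<in> unit_sphere E" "T k = inverse (norm b) *\<^sub>R b"
      using surj_isometryD(2)[OF T] by blast
    have kE: "k \<in> E" using k(1) by (simp add: unit_sphere_def)
    have "radial_extension (norm b *\<^sub>R k) = norm b *\<^sub>R T k"
      using radial_extension_scale[OF kE] ext[OF k(1)] by simp
    also have "\<dots> = b" using k(2) False by simp
    finally show ?thesis using E_scaleR[OF kE] by (metis image_eqI)
  qed
  then have "radial_extension ` E = B" using radial_extension_in by blast
  moreover have "dist (radial_extension f) (radial_extension g) = dist f g" if "f \<in> E" "g \<in> E" for f g
    unfolding dist_norm diff[OF that, symmetric] by (rule norm_radial_extension[OF E_diff[OF that]])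
  ultimately show "surj_isometry E B radial_extension" unfolding surj_isometry_def by blast
qed

end

section \<open>Subspaces of bounded continuous functions\<close>

lemma complete_bcontfun: "complete (UNIV :: ('a::topological_space \<Rightarrow>\<^sub>C 'b::complete_space) set)"
  unfolding complete_def
proof (intro allI impI)
  fix f :: "nat \<Rightarrow> 'a \<Rightarrow>\<^sub>C 'b"
  assume "(\<forall>n. f n \<in> UNIV) \<and> Cauchy f"
  then have "uniformly_Cauchy_on UNIV (\<lambda>n. apply_bcontfun (f n))"
    unfolding uniformly_Cauchy_on_def Cauchy_def by (meson dist_fun_lt_imp_dist_val_lt)
  then obtain l where "uniform_limit UNIV (\<lambda>n. apply_bcontfun (f n)) l sequentially"
    using Cauchy_uniformly_convergent uniformly_convergent_on_def by blast
  then show "\<exists>l\<in>UNIV. f \<longlonglongrightarrow> l"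
    using uniform_limit_bcontfunE[OF _ sequentially_bot] by blast
qed

theorem C_regular_complex_Mazur_Ulam:
  fixes E :: "('y::t2_space \<Rightarrow>\<^sub>C complex) set"
  assumes "E \<subseteq> C0" "complex_vector.subspace E" "closed E" "extremely_C_regular E"
  shows "complex_Mazur_Ulam TYPE('b::complex_normed_vector) E"
  unfolding complex_Mazur_Ulam_def
proof (intro conjI allI impI)
  have "complete E"
    using complete_bcontfun complete_closed_subset[OF assms(3) subset_UNIV] by blast
  then show "complex_banach_space E" using assms(2) by (simp add: complex_banach_space_def)
next
  fix B' :: "'b set" and T
  assume "complex_banach_space B'" "surj_isometry (unit_sphere E) (unit_sphere B') T"
  then interpret sphere_isometry E B' T
    using assms by unfold_locales (auto simp: complex_banach_space_def)
  show "\<exists>S. real_linear_on E S \<and> surj_isometry E B' S \<and> (\<forall>x\<in>unit_sphere E. S x = T x)"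
    using radial_extension_isometry by blast
qed

lemma extremely_regular_imp_C_regular: "extremely_regular E \<Longrightarrow> extremely_C_regular E"
  by (simp add: extremely_regular_def extremely_C_regular_def)

lemma subspace_C0: "complex_vector.subspace (C0 :: ('y::topological_space \<Rightarrow>\<^sub>C complex) set)"
  unfolding complex_vector.subspace_def
proof (intro conjI ballI allI)
  show "(0 :: 'y \<Rightarrow>\<^sub>C complex) \<in> C0" by (auto simp: C0_def intro!: exI[of _ "{}"])
next
  fix f g :: "'y \<Rightarrow>\<^sub>C complex"
  assume f: "f \<in> C0" and g: "g \<in> C0"
  show "f + g \<in> C0"
    unfolding C0_def
  proof (intro CollectI allI impI)
    fix \<epsilon> :: real assume "\<epsilon> > 0"
    then have "\<epsilon> / 2 > 0" by simp
    obtain K where K: "compact K" "\<And>y. y \<notin> K \<Longrightarrow> cmod (apply_bcontfun f y) < \<epsilon> / 2"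
      using f \<open>\<epsilon> / 2 > 0\<close> unfolding C0_def by blast
    obtain L where L: "compact L" "\<And>y. y \<notin> L \<Longrightarrow> cmod (apply_bcontfun g y) < \<epsilon> / 2"
      using g \<open>\<epsilon> / 2 > 0\<close> unfolding C0_def by blast
    have "cmod (apply_bcontfun (f + g) y) < \<epsilon>" if "y \<notin> K \<union> L" for y
      using K(2)[of y] L(2)[of y] that norm_triangle_ineq[of "apply_bcontfun f y" "apply_bcontfun g y"] by simp
    then show "\<exists>K. compact K \<and> (\<forall>y. y \<notin> K \<longrightarrow> cmod (apply_bcontfun (f + g) y) < \<epsilon>)"
      using compact_Un[OF K(1) L(1)] by blast
  qed
next
  fix c and f :: "'y \<Rightarrow>\<^sub>C complex"
  assume f: "f \<in> C0"
  show "c *\<^sub>C f \<in> C0"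
    unfolding C0_def
  proof (intro CollectI allI impI)
    fix \<epsilon> :: real assume "\<epsilon> > 0"
    define \<delta> where "\<delta> = \<epsilon> / (cmod c + 1)"
    have c1: "0 < cmod c + 1" by (simp add: add_nonneg_pos)
    then have "\<delta> > 0" using \<open>\<epsilon> > 0\<close> by (simp add: \<delta>_def)
    then obtain K where K: "compact K" "\<And>y. y \<notin> K \<Longrightarrow> cmod (apply_bcontfun f y) < \<delta>"
      using f unfolding C0_def by blast
    have "cmod (apply_bcontfun (c *\<^sub>C f) y) < \<epsilon>" if "y \<notin> K" for y
    proof -
      have "cmod (apply_bcontfun (c *\<^sub>C f) y) \<le> cmod c * \<delta>"
        using K(2)[OF that] by (simp add: norm_mult mult_left_mono)
      also have "\<dots> < (cmod c + 1) * \<delta>" using \<open>\<delta> > 0\<close> by simp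
      also have "\<dots> = \<epsilon>" using c1 by (simp add: \<delta>_def)
      finally show ?thesis .
    qed
    then show "\<exists>K. compact K \<and> (\<forall>y. y \<notin> K \<longrightarrow> cmod (apply_bcontfun (c *\<^sub>C f) y) < \<epsilon>)"
      using K(1) by blast
  qed
qed

lemma closed_C0: "closed (C0 :: ('y::topological_space \<Rightarrow>\<^sub>C complex) set)"
proof -
  have "f \<in> C0" if f: "f \<in> closure C0" for f :: "'y \<Rightarrow>\<^sub>C complex"
    unfolding C0_def
  proof (intro CollectI allI impI)
    fix \<epsilon> :: real assume "\<epsilon> > 0"
    then have e: "\<epsilon> / 2 > 0" by simp
    then obtain g where g: "g \<in> C0" "dist g f < \<epsilon> / 2" using f unfolding closure_approachable by blast
    obtain K where K: "compact K" "\<And>y. y \<notin> K \<Longrightarrow> cmod (apply_bcontfun g y) < \<epsilon> / 2"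
      using g(1) e unfolding C0_def by blast
    have "cmod (apply_bcontfun f y) < \<epsilon>" if "y \<notin> K" for y
    proof -
      have "cmod (apply_bcontfun f y) \<le> cmod (apply_bcontfun g y) + dist (apply_bcontfun g y) (apply_bcontfun f y)"
        unfolding dist_norm by (metis norm_minus_commute norm_triangle_sub)
      then show ?thesis using K(2)[OF that] dist_bounded[of g y f] g(2) by linarith
    qed
    then show "\<exists>K. compact K \<and> (\<forall>y. y \<notin> K \<longrightarrow> cmod (apply_bcontfun f y) < \<epsilon>)"
      using K(1) by blast
  qed
  then show ?thesis using closure_subset_eq by blast
qed

text \<open>A locally compact Hausdorff space is completely regular; separating \<open>x\<close> from the complement of a
  relatively compact neighbourhood inside \<open>U\<close> gives a function that vanishes
  off a compact set.\<close>

lemma extremely_regular_C0: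
  assumes lc: "locally_compact_space (euclidean :: 'y::t2_space topology)"
  shows "extremely_regular (C0 :: ('y \<Rightarrow>\<^sub>C complex) set)"
  unfolding extremely_regular_def peaks_at_def
proof (intro allI impI)
  fix x :: 'y and \<epsilon> :: real and U :: "'y set"
  assume "\<epsilon> > 0" "open U" "x \<in> U"
  have "\<exists>V. open V \<and> (\<exists>K. compact K \<and> x \<in> V \<and> V \<subseteq> K)"
    using lc by (simp add: locally_compact_space_def)
  then obtain V K where V: "open V" "compact K" "x \<in> V" "V \<subseteq> K" by blast
  have "Hausdorff_space (euclidean :: 'y topology)"
    unfolding Hausdorff_space_def disjnt_def using hausdorff by (simp add: Bex_def) blast
  then have "completely_regular_space (euclidean :: 'y topology)"
    using lc by (intro locally_compact_regular_imp_completely_regular_space) auto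
  moreover have "closed (- (U \<inter> V))" "x \<notin> - (U \<inter> V)"
    using \<open>open U\<close> \<open>x \<in> U\<close> V by (auto intro: closed_Compl open_Int)
  ultimately obtain f :: "'y \<Rightarrow> real" where f: "continuous_map euclidean (top_of_set {0..1}) f"
    "f x = 0" "f ` (- (U \<inter> V)) \<subseteq> {1}"
    unfolding completely_regular_space_def by (metis DiffI UNIV_I closed_closedin topspace_euclidean)
  have cont: "continuous_on UNIV f" and range: "f y \<in> {0..1}" for y
    using f(1) by (auto simp: continuous_map_in_subtopology)
  define g where "g y = complex_of_real (1 - f y)" for y
  have "continuous_on UNIV g" unfolding g_def by (intro continuous_intros cont)
  moreover have g_le: "cmod (g y) \<le> 1" for y
    using range[of y] unfolding g_def norm_of_real by simp
  ultimately have "g \<in> bcontfun" by (rule bcontfun_normI)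
  then obtain h where h: "g = apply_bcontfun h" by (rule bcontfunE)
  have zero: "apply_bcontfun h y = 0" if "y \<notin> U \<inter> V" for y
    using f(3) that unfolding h[symmetric] by (force simp: g_def)
  have one: "apply_bcontfun h x = 1" unfolding h[symmetric] by (simp add: g_def f(2))
  have "h \<in> C0"
    unfolding C0_def
  proof (intro CollectI allI impI exI[of _ K] conjI)
    show "compact K" by (rule V(2))
    show "cmod (apply_bcontfun h y) < \<delta>" if "\<delta> > 0" "y \<notin> K" for \<delta> :: real and y
    proof -
      have "y \<notin> U \<inter> V" using that(2) V(4) by blast
      then show ?thesis using zero that(1) by simp
    qed
  qed
  moreover have "norm h = 1"
    using norm_bounded[of h x] one norm_bound[of h 1] g_le by (simp add: h)
  moreover have "\<forall>y. y \<notin> U \<longrightarrow> cmod (apply_bcontfun h y) < \<epsilon>"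
    using zero \<open>\<epsilon> > 0\<close> by simp
  ultimately show "\<exists>f\<in>C0. apply_bcontfun f x = 1 \<and> norm f = 1 \<and> (\<forall>y. y \<notin> U \<longrightarrow> cmod (apply_bcontfun f y) < \<epsilon>)"
    using one by blast
qed

theorem corollary6p4:
  assumes "locally_compact_space (euclidean :: 'y::t2_space topology)"
  shows
    "(\<forall>E :: ('y \<Rightarrow>\<^sub>C complex) set.
        E \<subseteq> C0 \<longrightarrow> complex_vector.subspace E \<longrightarrow> closed E \<longrightarrow> extremely_C_regular E \<longrightarrow>
        complex_Mazur_Ulam TYPE('b::complex_normed_vector) E) \<and>
     complex_Mazur_Ulam TYPE('b) (C0 :: ('y \<Rightarrow>\<^sub>C complex) set) \<and>
     (\<forall>E :: ('y \<Rightarrow>\<^sub>C complex) set.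
        E \<subseteq> C0 \<longrightarrow> complex_vector.subspace E \<longrightarrow> closed E \<longrightarrow> extremely_regular E \<longrightarrow>
        complex_Mazur_Ulam TYPE('b) E)"
proof (intro conjI allI impI)
  show "complex_Mazur_Ulam TYPE('b) (C0 :: ('y \<Rightarrow>\<^sub>C complex) set)"
    using extremely_regular_imp_C_regular[OF extremely_regular_C0[OF assms]]
    by (rule C_regular_complex_Mazur_Ulam[OF order_refl subspace_C0 closed_C0])
qed (blast intro: C_regular_complex_Mazur_Ulam extremely_regular_imp_C_regular)+

end
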